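(* Let $\alpha\in(0,1)$ and $1\le p,q\le\infty$. Then $$\|f\|_{\mathrm{wav},\alpha,p,q}\le C_p\,\|f\|^{(b)}_{B^\alpha_{p,q}}\qquad\text{for all }f\in B^\alpha_{p,q}([0,1]),$$ where $C_p=\max\{1,2^{1/p}(1-1/b)b^\alpha\}$. In particular, $B^\alpha_{p,q}([0,1])\hookrightarrow\mathcal{H}_{\mathrm{wav},\alpha,p,q}$ continuously.
   Context: Convention $1/\infty=0$. Besov space on $[0,1]$: for $f\in L_p([0,1])$ and $0<\delta\le1$ let $\omega_p(f,\delta)=\sup_{0<h\le\delta}\big(\int_0^{1-h}|f(x+h)-f(x)|^pdx\big)^{1/p}$ (for $p=\infty$: $\sup_{h\le\delta}\operatorname{ess\,sup}_{0\le x\le1-h}|f(x+h)-f(x)|$). $B^\alpha_{p,q}([0,1])$ is the space of locally integrable $f$ with $\|f\|_{L_p}+\big(\int_0^1(t^{-\alpha}\omega_p(f,t))^q\frac{dt}{t}\big)^{1/q}<\infty$ (ess sup over $t\in(0,1]$ of $t^{-\alpha}\omega_p(f,t)$ if $q=\infty$). For an integer $b\ge2$, the equivalent norm is $\|f\|^{(b)}_{B^\alpha_{p,q}}=\|f\|_{L_p}+\big(\sum_{j=0}^\infty b^{j\alpha q}\omega_p(f,b^{-j})^q\big)^{1/q}$ (with $\sup_j b^{j\alpha}\omega_p(f,b^{-j})$ if $q=\infty$). Haar wavelet space (same base $b$): $\Delta_{-1}=\{0\}$, $\Delta_j=\{0,\dots,b^j-1\}$, $\nabla_0=\{0\}$,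 $\nabla_j=\{0,\dots,b-1\}$ ($j\ge1$); $\psi^0_{0,0}=1_{[0,1)}$ and for $j\ge1$, $i\in\nabla_j$, $k\in\Delta_{j-1}$: $\psi^j_{i,k}(x)=b^{j/2-1}(b\,1_{[b^{-j}(bk+i),b^{-j}(bk+i+1))}(x)-1_{[b^{1-j}k,b^{1-j}(k+1))}(x))$. For $f\in L_1([0,1])$, $\|f\|^q_{\mathrm{wav},\alpha,p,q}=\sum_{j=0}^\infty b^{q(\alpha-1/p+1/2)j}\big(\sum_{k\in\Delta_{j-1}}\sum_{i\in\nabla_j}|\langle f,\psi^j_{i,k}\rangle|^p\big)^{q/p}$ with $\langle f,g\rangle=\int_0^1fg$ (maximum if $p=\infty$, supremum over $j$ if $q=\infty$). $\mathcal{H}_{\mathrm{wav},\alpha,p,q}$ is the space of $f\in L_1([0,1])$ with finite norm; for $q=\infty$ it is additionally required that the wavelet series $\sum_{j,k,i}\langle f,\psi^j_{i,k}\rangle\psi^j_{i,k}$ converge pointwise and equal $f$ a.e. *)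

theory Defs
  imports "HOL-Analysis.Analysis" "HOL-Probability.Essential_Supremum"
begin

text \<open>Real power of an extended nonnegative real (exponent r > 0), with infinity mapped to infinity.\<close>
definition epow :: "ennreal \<Rightarrow> real \<Rightarrow> ennreal" where
  "epow x r = (if x = \<infinity> then \<infinity> else ennreal (enn2real x powr r))"

definition inv_exp :: "ennreal \<Rightarrow> real" where
  "inv_exp p = (if p = \<infinity> then 0 else 1 / enn2real p)"

definition Lp_norm_on :: "ennreal \<Rightarrow> real set \<Rightarrow> (real \<Rightarrow> real) \<Rightarrow> ennreal" where
  "Lp_norm_on p S g =
     (if p = \<infinity> then esssup (lebesgue_on S) (\<lambda>x. ennreal \<bar>g x\<bar>)
      else epow (\<integral>\<^sup>+ x \<in> S. epow (ennreal \<bar>g x\<bar>) (enn2real p) \<partial>lebesgue) (1 / enn2real p))"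

definition omega :: "ennreal \<Rightarrow> (real \<Rightarrow> real) \<Rightarrow> real \<Rightarrow> ennreal" where
  "omega p f \<delta> = (SUP h \<in> {0<..\<delta>}. Lp_norm_on p {0..1-h} (\<lambda>x. f (x + h) - f x))"

definition besov_norm :: "real \<Rightarrow> ennreal \<Rightarrow> ennreal \<Rightarrow> (real \<Rightarrow> real) \<Rightarrow> ennreal" where
  "besov_norm \<alpha> p q f = Lp_norm_on p {0..1} f +
     (if q = \<infinity> then esssup (lebesgue_on {0<..1}) (\<lambda>t. ennreal (t powr (-\<alpha>)) * omega p f t)
      else epow (\<integral>\<^sup>+ t \<in> {0<..1}. epow (ennreal (t powr (-\<alpha>)) * omega p f t) (enn2real q)
                    * ennreal (1 / t) \<partial>lebesgue) (1 / enn2real q))"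

definition besov_space :: "real \<Rightarrow> ennreal \<Rightarrow> ennreal \<Rightarrow> (real \<Rightarrow> real) set" where
  "besov_space \<alpha> p q = {f. f \<in> borel_measurable (lebesgue_on {0..1}) \<and> besov_norm \<alpha> p q f < \<infinity>}"

definition besov_norm_b :: "nat \<Rightarrow> real \<Rightarrow> ennreal \<Rightarrow> ennreal \<Rightarrow> (real \<Rightarrow> real) \<Rightarrow> ennreal" where
  "besov_norm_b b \<alpha> p q f = Lp_norm_on p {0..1} f +
     (if q = \<infinity> then (SUP j::nat. ennreal (real b powr (real j * \<alpha>)) * omega p f (real b powr (- real j)))
      else epow (\<Sum>j. epow (ennreal (real b powr (real j * \<alpha>)) * omega p f (real b powr (- real j)))
                   (enn2real q)) (1 / enn2real q))"

definition Kset :: "nat \<Rightarrow> nat \<Rightarrow> nat set" where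
  "Kset b j = (if j = 0 then {0} else {0..<b ^ (j - 1)})"

definition Iset :: "nat \<Rightarrow> nat \<Rightarrow> nat set" where
  "Iset b j = (if j = 0 then {0} else {0..<b})"

definition haar :: "nat \<Rightarrow> nat \<Rightarrow> nat \<Rightarrow> nat \<Rightarrow> real \<Rightarrow> real" where
  "haar b j i k x =
    (if j = 0 then indicator {0..<1} x
     else real b powr (real j / 2 - 1) *
       (real b * indicator {real (b * k + i) / real b ^ j ..< real (b * k + i + 1) / real b ^ j} x
        - indicator {real k / real b ^ (j - 1) ..< real (k + 1) / real b ^ (j - 1)} x))"

definition wcoef :: "nat \<Rightarrow> (real \<Rightarrow> real) \<Rightarrow> nat \<Rightarrow> nat \<Rightarrow> nat \<Rightarrow> real" where
  "wcoef b f j i k = (\<integral> x \<in> {0..1}. f x * haar b j i k x \<partial>lebesgue)"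

definition level_norm :: "nat \<Rightarrow> ennreal \<Rightarrow> (real \<Rightarrow> real) \<Rightarrow> nat \<Rightarrow> ennreal" where
  "level_norm b p f j =
    (if p = \<infinity> then (SUP (k, i) \<in> Kset b j \<times> Iset b j. ennreal \<bar>wcoef b f j i k\<bar>)
     else epow (\<Sum>k \<in> Kset b j. \<Sum>i \<in> Iset b j. ennreal (\<bar>wcoef b f j i k\<bar> powr enn2real p))
               (1 / enn2real p))"

definition wav_norm :: "nat \<Rightarrow> real \<Rightarrow> ennreal \<Rightarrow> ennreal \<Rightarrow> (real \<Rightarrow> real) \<Rightarrow> ennreal" where
  "wav_norm b \<alpha> p q f =
    (if q = \<infinity> then (SUP j::nat. ennreal (real b powr ((\<alpha> - inv_exp p + 1/2) * real j)) * level_norm b p f j)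
     else epow (\<Sum>j. epow (ennreal (real b powr ((\<alpha> - inv_exp p + 1/2) * real j)) * level_norm b p f j)
                  (enn2real q)) (1 / enn2real q))"

definition wav_space :: "nat \<Rightarrow> real \<Rightarrow> ennreal \<Rightarrow> ennreal \<Rightarrow> (real \<Rightarrow> real) set" where
  "wav_space b \<alpha> p q = {f. integrable (lebesgue_on {0..1}) f \<and> wav_norm b \<alpha> p q f < \<infinity> \<and>
     (q = \<infinity> \<longrightarrow> (AE x in lebesgue_on {0..1}.
        (\<lambda>J. \<Sum>j<J. \<Sum>k \<in> Kset b j. \<Sum>i \<in> Iset b j. wcoef b f j i k * haar b j i k x) \<longlonglongrightarrow> f x))}"

end

theory Submission
  imports Defs
begin

text \<open>
  A Haar coefficient at level \<open>j \<ge> 1\<close> is, up to the factor \<open>b\<^bsup>j/2-1\<^esup>\<close>, a sum of \<open>b - 1\<close> differences of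
  integrals of \<open>f\<close> over two \<open>b\<close>-adic intervals of length \<open>b\<^bsup>-j\<^esup>\<close> with a common parent. Each difference is an
  integral of \<open>f(x + h) - f(x)\<close> with \<open>0 < h < b\<^bsup>1-j\<^esup>\<close> a multiple of \<open>b\<^bsup>-j\<^esup>\<close>. Hoelder's inequality and
  summation over all pairs (every \<open>h\<close> occurs at most twice at each position, hence the factor \<open>2\<^bsup>1/p\<^esup>\<close>) bound the
  level by the modulus of smoothness at \<open>b\<^bsup>1-j\<^esup>\<close>. The \<open>\<ell>\<^sub>q\<close> sum over the levels then follows from
  \<open>u\<^sup>q + v\<^sup>q \<le> (u + v)\<^sup>q\<close>.

  The partial sums of the Haar series are the averages \<open>E\<^sub>n f\<close> over \<open>b\<close>-adic cells. By Fubini,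
  \<open>\<integral>|E\<^sub>n f - f| \<le> 2 \<omega>\<^sub>1(f, b\<^bsup>-n\<^esup>) = O(b\<^bsup>-\<alpha>n\<^esup>)\<close> is summable in \<open>n\<close>, so \<open>E\<^sub>n f\<close> converges to \<open>f\<close> almost
  everywhere without any differentiation theorem.
\<close>

subsection \<open>Powers of extended nonnegative reals and Hoelder bounds\<close>

lemma epow_ennreal: "0 \<le> x \<Longrightarrow> epow (ennreal x) r = ennreal (x powr r)"
  by (simp add: epow_def)

lemma epow_top [simp]: "epow \<infinity> r = \<infinity>" "epow top r = top"
  by (simp_all add: epow_def)

lemma epow_zero [simp]: "epow 0 r = 0"
  by (simp add: epow_def)

lemma epow_one [simp]: "epow x 1 = x"
  by (cases x) (auto simp: epow_def)

lemma epow_eq_top_iff [simp]: "epow x r = \<infinity> \<longleftrightarrow> x = \<infinity>" "epow x r = top \<longleftrightarrow> x = top"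
  by (simp_all add: epow_def)

lemma epow_less_top_iff [simp]: "epow x r < \<infinity> \<longleftrightarrow> x < \<infinity>" "epow x r < top \<longleftrightarrow> x < top"
  by (metis epow_eq_top_iff(2) infinity_ennreal_def top.not_eq_extremum)+

lemma epow_mono: "x \<le> y \<Longrightarrow> 0 \<le> r \<Longrightarrow> epow x r \<le> epow y r"
  by (cases x; cases y) (auto simp: epow_def top_unique intro!: powr_mono2 ennreal_leI)

lemma epow_mult:
  assumes "0 < r"
  shows "epow (x * y) r = epow x r * epow y r"
proof (cases "x = 0 \<or> y = 0")
  case False
  then show ?thesis
    by (cases x; cases y)
      (auto simp: epow_def ennreal_mult_eq_top_iff ennreal_top_mult ennreal_mult_top
        powr_mult ennreal_mult[symmetric])
qed auto

lemma epow_epow: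
  assumes "0 < r"
  shows "epow (epow x r) s = epow x (r * s)"
  by (cases x) (auto simp: epow_def powr_powr)

lemma epow_le_imp_le_epow:
  assumes "epow x r \<le> y" "0 < r"
  shows "x \<le> epow y (1 / r)"
proof -
  have "epow (epow x r) (1 / r) \<le> epow y (1 / r)"
    using assms by (intro epow_mono) auto
  then show ?thesis
    using assms by (simp add: epow_epow)
qed

text \<open>For finite \<open>x\<close>, \<open>y\<close> write \<open>u powr r\<close> as
  \<open>u * u powr (r - 1)\<close> and enlarge the second factor to a power of the sum. This later
  merges level 0 with the remaining levels at no cost in the constant.\<close>

lemma epow_add_le:
  assumes "1 \<le> r"
  shows "epow x r + epow y r \<le> epow (x + y) r"
proof (cases "x = \<infinity> \<or> y = \<infinity>")
  case False
  then obtain a c where ac: "x = ennreal a" "y = ennreal c" "0 \<le> a" "0 \<le> c"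
    by (cases x; cases y) auto
  have split: "u powr r = u * u powr (r - 1)" if "0 \<le> u" for u :: real
    using that by (cases "u = 0") (auto simp: powr_mult_base)
  have "a powr r + c powr r \<le> a * (a + c) powr (r - 1) + c * (a + c) powr (r - 1)"
    using ac assms by (subst (1 2) split) (auto intro!: add_mono mult_left_mono powr_mono2)
  also have "\<dots> = (a + c) powr r"
    using ac by (simp add: split algebra_simps)
  finally show ?thesis
    using ac by (simp add: epow_ennreal ennreal_plus[symmetric] del: ennreal_plus)
qed auto

lemma borel_measurable_epow [measurable]:
  assumes [measurable]: "u \<in> borel_measurable M"
  shows "(\<lambda>x. epow (u x) r) \<in> borel_measurable M"
  unfolding epow_def by measurable

text \<open>By convexity the graph of the power lies above its tangent at \<open>c\<close>. The
  constant term is moved to the right-hand side, so that no subtraction in \<open>ennreal\<close>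
  occurs. The real inequality is Young's with weights 1/r and 1 - 1/r.\<close>

lemma epow_tangent:
  assumes "1 \<le> r" "0 < c"
  shows "ennreal (r * c powr (r - 1)) * y \<le> epow y r + ennreal ((r - 1) * c powr r)"
proof (cases y)
  case (real a)
  have "r * c powr (r - 1) * a \<le> a powr r + (r - 1) * c powr r"
  proof (cases "a = 0")
    case False
    then have "a > 0" using real by simp
    have "(a powr r) powr (1 / r) * (c powr r) powr (1 - 1 / r)
        \<le> (1 / r) * a powr r + (1 - 1 / r) * c powr r"
      using assms \<open>a > 0\<close> by (intro Youngs_inequality_0) auto
    moreover have "(a powr r) powr (1 / r) = a" "(c powr r) powr (1 - 1 / r) = c powr (r - 1)"
      using assms \<open>a > 0\<close> by (auto simp: powr_powr algebra_simps)
    ultimately have "r * (a * c powr (r - 1)) \<le> r * ((1 / r) * a powr r + (1 - 1 / r) * c powr r)"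
      using assms by (intro mult_left_mono) auto
    then show ?thesis
      using assms by (simp add: algebra_simps)
  qed (use assms in auto)
  then show ?thesis
    using real assms
    by (simp add: epow_ennreal ennreal_mult[symmetric] ennreal_plus[symmetric] ennreal_leI del: ennreal_plus)
qed (use assms in auto)

text \<open>Jensen's inequality for the power \<open>r\<close> on a space of total mass
  \<open>s\<close>, obtained by integrating the tangent inequality at the mean value of
  \<open>u\<close>.\<close>

lemma nn_integral_power_mean:
  assumes [measurable]: "u \<in> borel_measurable M"
    and s: "emeasure M (space M) = ennreal s" "0 < s" and r: "1 \<le> r"
  shows "epow (\<integral>\<^sup>+x. u x \<partial>M) r \<le> ennreal (s powr (r - 1)) * (\<integral>\<^sup>+x. epow (u x) r \<partial>M)"
proof -
  consider "(\<integral>\<^sup>+x. epow (u x) r \<partial>M) = \<infinity>" | "(\<integral>\<^sup>+x. u x \<partial>M) = 0"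
    | "(\<integral>\<^sup>+x. epow (u x) r \<partial>M) < \<infinity>" "(\<integral>\<^sup>+x. u x \<partial>M) \<noteq> 0"
    by (metis infinity_ennreal_def top.not_eq_extremum)
  then show ?thesis
  proof cases
    case 1
    then show ?thesis using s by (simp add: ennreal_mult_top)
  next
    case 2
    then show ?thesis by simp
  next
    case 3
    have tangent: "ennreal (r * c powr (r - 1)) * (\<integral>\<^sup>+x. u x \<partial>M)
        \<le> (\<integral>\<^sup>+x. epow (u x) r \<partial>M) + ennreal ((r - 1) * c powr r * s)" if "0 < c" for c
    proof -
      have "ennreal (r * c powr (r - 1)) * (\<integral>\<^sup>+x. u x \<partial>M) = (\<integral>\<^sup>+x. ennreal (r * c powr (r - 1)) * u x \<partial>M)"
        by (simp add: nn_integral_cmult)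
      also have "\<dots> \<le> (\<integral>\<^sup>+x. epow (u x) r + ennreal ((r - 1) * c powr r) \<partial>M)"
        using r that by (intro nn_integral_mono epow_tangent) auto
      also have "\<dots> = (\<integral>\<^sup>+x. epow (u x) r \<partial>M) + ennreal ((r - 1) * c powr r * s)"
        using s r by (simp add: nn_integral_add ennreal_mult)
      finally show ?thesis .
    qed
    \<comment> \<open>The tangent at 1 shows that \<open>u\<close> is integrable as soon as its
      power is, so a mean value exists.\<close>
    have "ennreal r * (\<integral>\<^sup>+x. u x \<partial>M) < \<infinity>"
      using tangent[of 1] 3(1) r by (simp add: le_less_trans ennreal_add_eq_top less_top)
    then have "(\<integral>\<^sup>+x. u x \<partial>M) < \<infinity>"
      using r by (auto simp: ennreal_mult_less_top)
    then obtain a where a: "(\<integral>\<^sup>+x. u x \<partial>M) = ennreal a" "0 < a"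
      using 3(2) by (cases "\<integral>\<^sup>+x. u x \<partial>M") (auto simp: less_le)
    obtain d where d: "(\<integral>\<^sup>+x. epow (u x) r \<partial>M) = ennreal d" "0 \<le> d"
      using 3(1) by (cases "\<integral>\<^sup>+x. epow (u x) r \<partial>M") auto
    \<comment> \<open>At the mean value the tangent inequality becomes
      \<open>r * c powr r * s\<close> \<le> \<open>d + (r - 1) * c powr r * s\<close>, and
      subtracting leaves exactly Jensen's bound.\<close>
    define c where "c = a / s"
    have "c > 0" and ac: "a = c * s"
      using a s by (auto simp: c_def)
    have cr: "c powr (r - 1) * c = c powr r"
      using \<open>c > 0\<close> by (simp add: powr_diff)
    have "r * c powr (r - 1) * a \<le> d + (r - 1) * c powr r * s"
      using tangent[OF \<open>c > 0\<close>] a d s r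
      by (simp add: ennreal_mult[symmetric] ennreal_plus[symmetric] del: ennreal_plus)
    then have "c powr r * s \<le> d"
      unfolding ac cr[symmetric] by (simp add: algebra_simps)
    then have "s powr (r - 1) * (c powr r * s) \<le> s powr (r - 1) * d"
      by (intro mult_left_mono) auto
    moreover have "s powr (r - 1) * (c powr r * s) = a powr r"
      using s \<open>c > 0\<close> by (simp add: ac powr_mult powr_diff)
    ultimately show ?thesis
      using a d by (simp add: epow_ennreal ennreal_mult[symmetric] ennreal_leI)
  qed
qed

text \<open>The previous inequality for counting measure on \<open>A\<close>, whose total mass is
  \<open>card A\<close>.\<close>

lemma sum_power_mean:
  assumes "finite A" "A \<noteq> {}" "1 \<le> r"
  shows "epow (\<Sum>i\<in>A. u i) r \<le> ennreal (real (card A) powr (r - 1)) * (\<Sum>i\<in>A. epow (u i) r)"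
  using nn_integral_power_mean[of u "count_space A" "real (card A)" r] assms
  by (simp add: nn_integral_count_space_finite emeasure_count_space card_gt_0_iff ennreal_of_nat_eq_real_of_nat)

lemma one_le_enn2real:
  assumes "1 \<le> p" "p \<noteq> \<infinity>"
  shows "1 \<le> enn2real p"
  using assms by (cases p) auto

lemma Lp_norm_on_mono_set:
  assumes "S \<subseteq> T" and [measurable]: "S \<in> sets lebesgue" "T \<in> sets lebesgue"
    and [measurable]: "g \<in> borel_measurable lebesgue"
  shows "Lp_norm_on p S g \<le> Lp_norm_on p T g"
proof (cases "p = \<infinity>")
  case True
  have "AE x in lebesgue_on T. ennreal \<bar>g x\<bar> \<le> Lp_norm_on p T g"
    using True by (simp add: Lp_norm_on_def esssup_AE)
  then have "AE x in lebesgue_on S. ennreal \<bar>g x\<bar> \<le> Lp_norm_on p T g"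
    using assms(1) by (auto simp: AE_restrict_space_iff elim: eventually_mono)
  then show ?thesis
    using True unfolding Lp_norm_on_def
    by (auto intro!: esssup_I measurable_restrict_space1)
next
  case False
  then show ?thesis
    using assms(1) unfolding Lp_norm_on_def
    by (auto intro!: epow_mono nn_integral_mono split: split_indicator)
qed

text \<open>Hoelder's inequality against the constant 1. For finite p it is the r-th root of the
  power mean inequality. For p = \<infinity> the convention \<open>inv_exp p = 0\<close> gives the
  full factor \<open>s\<close>.\<close>

lemma nn_integral_le_Lp_norm_on:
  assumes [measurable]: "S \<in> sets lebesgue" "g \<in> borel_measurable lebesgue"
    and s: "emeasure lebesgue S = ennreal s" "0 < s" and p: "1 \<le> p"
  shows "(\<integral>\<^sup>+x\<in>S. ennreal \<bar>g x\<bar> \<partial>lebesgue) \<le> ennreal (s powr (1 - inv_exp p)) * Lp_norm_on p S g"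
proof (cases "p = \<infinity>")
  case True
  have "AE x in lebesgue_on S. ennreal \<bar>g x\<bar> \<le> Lp_norm_on p S g"
    using True by (simp add: Lp_norm_on_def esssup_AE)
  then have "(\<integral>\<^sup>+x\<in>S. ennreal \<bar>g x\<bar> \<partial>lebesgue) \<le> (\<integral>\<^sup>+x\<in>S. Lp_norm_on p S g \<partial>lebesgue)"
    by (intro nn_integral_mono_AE) (auto simp: AE_restrict_space_iff split: split_indicator elim: eventually_mono)
  also have "\<dots> = ennreal (s powr (1 - inv_exp p)) * Lp_norm_on p S g"
    using True s by (subst nn_integral_cmult_indicator) (auto simp: inv_exp_def mult.commute simp del: emeasure_completion)
  finally show ?thesis .
next
  case False
  define r where "r = enn2real p"
  have r: "1 \<le> r" using one_le_enn2real[OF p False] by (simp add: r_def)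
  have restr: "(\<integral>\<^sup>+x. F x \<partial>lebesgue_on S) = (\<integral>\<^sup>+x\<in>S. F x \<partial>lebesgue)" for F
    by (simp add: nn_integral_restrict_space)
  have "epow (\<integral>\<^sup>+x. ennreal \<bar>g x\<bar> \<partial>lebesgue_on S) r
      \<le> ennreal (s powr (r - 1)) * (\<integral>\<^sup>+x. epow (ennreal \<bar>g x\<bar>) r \<partial>lebesgue_on S)"
    using s r by (intro nn_integral_power_mean) (auto simp: emeasure_restrict_space intro!: measurable_restrict_space1)
  then have "(\<integral>\<^sup>+x\<in>S. ennreal \<bar>g x\<bar> \<partial>lebesgue)
      \<le> epow (ennreal (s powr (r - 1)) * (\<integral>\<^sup>+x\<in>S. epow (ennreal \<bar>g x\<bar>) r \<partial>lebesgue)) (1 / r)"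
    using r unfolding restr by (intro epow_le_imp_le_epow) auto
  also have "\<dots> = ennreal (s powr (1 - inv_exp p)) * Lp_norm_on p S g"
    using False r by (simp add: epow_mult epow_ennreal powr_powr Lp_norm_on_def inv_exp_def flip: r_def)
      (simp add: field_simps)
  finally show ?thesis .
qed

subsection \<open>Adic cells and Haar coefficients\<close>

text \<open>The intervals are half-open, so that those of a fixed level are disjoint and membership
  is a condition on the floor of \<open>x * real b ^ n\<close>. Disjointness and nesting thereby
  become integer arithmetic.\<close>

definition cell :: "nat \<Rightarrow> nat \<Rightarrow> nat \<Rightarrow> real set" where
  "cell b n m = {real m / real b ^ n ..< real (m + 1) / real b ^ n}"

definition cell_integral :: "nat \<Rightarrow> (real \<Rightarrow> real) \<Rightarrow> nat \<Rightarrow> nat \<Rightarrow> real" where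
  "cell_integral b f n m = (\<integral>x\<in>cell b n m. f x \<partial>lebesgue)"

lemma cell_sets_borel [measurable]: "cell b n m \<in> sets borel"
  by (simp add: cell_def)

lemma cell_sets_lebesgue [measurable]: "cell b n m \<in> sets lebesgue"
  by (simp add: cell_def)

lemma emeasure_cell: "0 < b \<Longrightarrow> emeasure lebesgue (cell b n m) = ennreal (1 / real b ^ n)"
  by (simp add: cell_def divide_right_mono diff_divide_distrib[symmetric])

lemma in_cell_iff_floor: "0 < b \<Longrightarrow> x \<in> cell b n m \<longleftrightarrow> \<lfloor>x * real b ^ n\<rfloor> = int m"
  by (simp add: cell_def floor_eq_iff pos_divide_le_eq pos_less_divide_eq add.commute)

lemma in_cell_shift_iff: "0 < b \<Longrightarrow> x + real d / real b ^ n \<in> cell b n (m + d) \<longleftrightarrow> x \<in> cell b n m"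
  by (auto simp: cell_def add_divide_distrib)

lemma disjoint_family_on_cell: "0 < b \<Longrightarrow> disjoint_family_on (cell b n) A"
  by (auto simp: disjoint_family_on_def in_cell_iff_floor)

text \<open>If the cell shifted by \<open>d\<close> places still lies in the unit interval, then the
  original cell lies in the domain of the difference with step \<open>d / b ^ n\<close>.\<close>

lemma cell_subset:
  assumes "0 < b" "m + d < b ^ n"
  shows "cell b n m \<subseteq> {0..1 - real d / real b ^ n}"
proof -
  have "real (m + d + 1) \<le> real (b ^ n)"
    unfolding of_nat_le_iff using assms(2) by simp
  then have "real (m + 1) \<le> real b ^ n - real d"
    by simp
  then have "real (m + 1) / real b ^ n \<le> 1 - real d / real b ^ n"
    using assms(1) divide_right_mono[of "real (m + 1)" "real b ^ n - real d" "real b ^ n"]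
    by (simp add: diff_divide_distrib)
  moreover have "0 \<le> real m / real b ^ n"
    by simp
  ultimately show ?thesis
    unfolding cell_def by (intro subsetI) (simp only: atLeastLessThan_iff atLeastAtMost_iff; linarith)
qed

text \<open>The floor at level \<open>n\<close> is the floor at level \<open>Suc n\<close> divided
  by \<open>b\<close>; the remainder \<open>i\<close> numbers the child.\<close>

lemma in_cell_Suc_iff:
  assumes "0 < b"
  shows "x \<in> cell b n k \<longleftrightarrow> (\<exists>i<b. x \<in> cell b (Suc n) (b * k + i))"
proof -
  have *: "\<lfloor>x * real b ^ n\<rfloor> = \<lfloor>x * real b ^ Suc n\<rfloor> div int b"
    using floor_divide_real_eq_div[of "int b" "x * real b ^ Suc n"] assms
    by simp
  have "(z div int b = int k) \<longleftrightarrow> (\<exists>i<b. z = int (b * k + i))" for z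
  proof
    assume "z div int b = int k"
    then have "z = int b * int k + z mod int b"
      by (metis mult_div_mod_eq)
    moreover have "0 \<le> z mod int b" "z mod int b < int b"
      using assms by auto
    ultimately show "\<exists>i<b. z = int (b * k + i)"
      by (intro exI[of _ "nat (z mod int b)"]) auto
  qed (use assms in auto)
  then show ?thesis
    unfolding in_cell_iff_floor[OF assms] * by simp
qed

lemma cell_Suc: "0 < b \<Longrightarrow> cell b n k = (\<Union>i<b. cell b (Suc n) (b * k + i))"
  by (rule set_eqI, subst in_cell_Suc_iff) auto

lemma set_integrable_of_integrable:
  "integrable lebesgue f \<Longrightarrow> S \<in> sets lebesgue \<Longrightarrow> set_integrable lebesgue S (f :: real \<Rightarrow> real)"
  unfolding set_integrable_def by (rule integrable_mult_indicator)

lemma cell_integral_Suc: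
  assumes "integrable lebesgue f" "0 < b"
  shows "cell_integral b f n k = (\<Sum>i<b. cell_integral b f (Suc n) (b * k + i))"
proof -
  have "disjoint_family_on (\<lambda>i. cell b (Suc n) (b * k + i)) {..<b}"
    using assms(2) by (auto simp: disjoint_family_on_def in_cell_iff_floor)
  then show ?thesis
    unfolding cell_integral_def
    by (subst cell_Suc[OF assms(2)]) (intro set_integral_finite_Union set_integrable_of_integrable assms(1) cell_sets_lebesgue finite_lessThan)
qed

text \<open>Composition with a Borel map need not preserve Lebesgue measurability, but an invertible
  affine map carries null sets to null sets.\<close>

lemma borel_measurable_shift:
  fixes f :: "real \<Rightarrow> real"
  assumes "f \<in> borel_measurable lebesgue"
  shows "(\<lambda>x. f (x + h)) \<in> borel_measurable lebesgue"
proof -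
  have "(\<lambda>x. h + 1 * x) \<in> lebesgue \<rightarrow>\<^sub>M (lebesgue :: real measure)"
    using lebesgue_affine_measurable[where c = "\<lambda>x::real. 1" and t = h] by simp
  from measurable_compose[OF this assms] show ?thesis
    by (simp add: add.commute)
qed

text \<open>Translation invariance moves the integral over cell \<open>m + d\<close> to cell
  \<open>m\<close>, so the difference becomes one integral of \<open>f (x + h) - f x\<close> with
  \<open>h = d / b ^ n\<close>.\<close>

lemma cell_integral_diff_le:
  assumes "integrable lebesgue f" "0 < b"
  shows "ennreal \<bar>cell_integral b f n (m + d) - cell_integral b f n m\<bar>
    \<le> (\<integral>\<^sup>+x\<in>cell b n m. ennreal \<bar>f (x + real d / real b ^ n) - f x\<bar> \<partial>lebesgue)"
proof -
  define h where "h = real d / real b ^ n"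
  have int: "integrable lebesgue (\<lambda>x. f (x + h))"
    using lebesgue_integrable_real_affine[OF assms(1), of 1 h] by (simp add: add.commute)
  have "cell_integral b f n (m + d) = (\<integral>x. indicator (cell b n (m + d)) (h + 1 * x) *\<^sub>R f (h + 1 * x) \<partial>lebesgue)"
    unfolding cell_integral_def set_lebesgue_integral_def
    by (subst lebesgue_integral_real_affine[of 1 _ h]) auto
  also have "\<dots> = (\<integral>x\<in>cell b n m. f (x + h) \<partial>lebesgue)"
    unfolding set_lebesgue_integral_def using in_cell_shift_iff[OF assms(2), of _ d n m]
    by (intro Bochner_Integration.integral_cong) (auto simp: h_def add.commute indicator_def)
  finally have "cell_integral b f n (m + d) - cell_integral b f n m = (\<integral>x\<in>cell b n m. f (x + h) - f x \<partial>lebesgue)"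
    unfolding cell_integral_def
    using assms int by (simp add: set_integral_diff(2) set_integrable_of_integrable)
  moreover have "ennreal (norm (\<integral>x. indicator (cell b n m) x *\<^sub>R (f (x + h) - f x) \<partial>lebesgue))
      \<le> (\<integral>\<^sup>+x. ennreal (norm (indicator (cell b n m) x *\<^sub>R (f (x + h) - f x))) \<partial>lebesgue)"
    using assms int by (intro integral_norm_bound_ennreal integrable_mult_indicator) auto
  moreover have "(\<integral>\<^sup>+x. ennreal (norm (indicator (cell b n m) x *\<^sub>R (f (x + h) - f x))) \<partial>lebesgue)
      = (\<integral>\<^sup>+x\<in>cell b n m. ennreal \<bar>f (x + h) - f x\<bar> \<partial>lebesgue)"
    by (intro nn_integral_cong) (auto split: split_indicator)
  ultimately show ?thesis
    by (simp add: set_lebesgue_integral_def h_def)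
qed

lemma cell_subset_unit: "0 < b \<Longrightarrow> m < b ^ n \<Longrightarrow> cell b n m \<subseteq> {0..1}"
  using cell_subset[of b m 0 n] by simp

lemma block_index_less:
  fixes b k i n :: nat
  assumes "k < b ^ n" "i < b"
  shows "b * k + i < b ^ Suc n"
proof -
  have "b * k + i < b * (k + 1)" using assms by simp
  also have "\<dots> \<le> b * b ^ n" using assms by (intro mult_left_mono) auto
  finally show ?thesis by simp
qed

lemma wcoef_Suc:
  assumes "integrable lebesgue f" "0 < b" "k < b ^ n" "i < b"
  shows "wcoef b f (Suc n) i k = real b powr (real (Suc n) / 2 - 1)
    * (real b * cell_integral b f (Suc n) (b * k + i) - cell_integral b f n k)"
proof -
  let ?c = "real b powr (real (Suc n) / 2 - 1)"
  have sub: "cell b (Suc n) (b * k + i) \<subseteq> {0..1}" "cell b n k \<subseteq> {0..1}"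
    using assms block_index_less[of k b n i] by (simp_all add: cell_subset_unit del: power_Suc)
  have haar_cell: "indicator {0..1} x *\<^sub>R (f x * haar b (Suc n) i k x)
      = ?c * (real b * (indicator (cell b (Suc n) (b * k + i)) x *\<^sub>R f x) - indicator (cell b n k) x *\<^sub>R f x)" for x
  proof -
    have "haar b (Suc n) i k x = ?c * (real b * indicator (cell b (Suc n) (b * k + i)) x - indicator (cell b n k) x)"
      unfolding haar_def cell_def by (simp only: nat.simps(3) if_False diff_Suc_1)
    moreover have "x \<notin> cell b (Suc n) (b * k + i)" "x \<notin> cell b n k" if "x \<notin> {0..1}"
      using that sub by blast+
    ultimately show ?thesis
      by (cases "x \<in> {0..1}") (simp_all only: indicator_simps, simp_all add: algebra_simps)
  qed
  have "wcoef b f (Suc n) i k = (\<integral>x. ?c * (real b * (indicator (cell b (Suc n) (b * k + i)) x *\<^sub>R f x)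
      - indicator (cell b n k) x *\<^sub>R f x) \<partial>lebesgue)"
    unfolding wcoef_def set_lebesgue_integral_def
    by (intro Bochner_Integration.integral_cong refl haar_cell)
  also have "\<dots> = ?c * (real b * cell_integral b f (Suc n) (b * k + i) - cell_integral b f n k)"
    unfolding cell_integral_def set_lebesgue_integral_def
    using assms(1) by (subst integral_mult_right_zero, subst Bochner_Integration.integral_diff,
      simp_all only: integral_mult_right_zero integrable_mult_right integrable_mult_indicator cell_sets_lebesgue)
  finally show ?thesis .
qed

text \<open>The parent integral is the sum of the \<open>b\<close> child integrals, so
  \<open>b\<close> times the integral of child \<open>i\<close> minus the parent integral is the sum
  of the differences between child \<open>i\<close> and its siblings. Taking \<open>min\<close> and
  \<open>max\<close> orders each pair so that the shift is nonnegative.\<close>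

lemma wcoef_Suc_le:
  assumes "integrable lebesgue f" "0 < b" "k < b ^ n" "i < b"
  shows "ennreal \<bar>wcoef b f (Suc n) i k\<bar> \<le> ennreal (real b powr (real (Suc n) / 2 - 1)) *
    (\<Sum>i'\<in>{..<b} - {i}. \<integral>\<^sup>+x\<in>cell b (Suc n) (b * k + min i i').
       ennreal \<bar>f (x + real (max i i' - min i i') / real b ^ Suc n) - f x\<bar> \<partial>lebesgue)"
    (is "_ \<le> ennreal ?c * (\<Sum>i'\<in>_. ?X i')")
proof -
  let ?a = "\<lambda>i. cell_integral b f (Suc n) (b * k + i)"
  have le: "ennreal \<bar>?a i - ?a i'\<bar> \<le> ?X i'" for i'
  proof -
    have "\<bar>?a i - ?a i'\<bar> = \<bar>?a (max i i') - ?a (min i i')\<bar>"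
      by (auto simp: max_def min_def)
    also have "?a (max i i') = cell_integral b f (Suc n) ((b * k + min i i') + (max i i' - min i i'))"
      by (rule arg_cong[where f = "cell_integral b f (Suc n)"]) auto
    finally show ?thesis
      using cell_integral_diff_le[OF assms(1,2), of "Suc n" "b * k + min i i'" "max i i' - min i i'"] by simp
  qed
  have "real b * ?a i - cell_integral b f n k = (\<Sum>i'<b. ?a i - ?a i')"
    unfolding cell_integral_Suc[OF assms(1,2), of n k] sum_subtractf by simp
  also have "\<dots> = (\<Sum>i'\<in>{..<b} - {i}. ?a i - ?a i')"
    by (intro sum.mono_neutral_right) auto
  finally have "ennreal \<bar>wcoef b f (Suc n) i k\<bar> = ennreal (?c * \<bar>\<Sum>i'\<in>{..<b} - {i}. ?a i - ?a i'\<bar>)"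
    using wcoef_Suc[OF assms] by (simp add: abs_mult del: power_Suc)
  also have "\<dots> \<le> ennreal (?c * (\<Sum>i'\<in>{..<b} - {i}. \<bar>?a i - ?a i'\<bar>))"
    by (rule ennreal_leI[OF mult_left_mono[OF sum_abs]]) simp
  also have "\<dots> = ennreal ?c * (\<Sum>i'\<in>{..<b} - {i}. ennreal \<bar>?a i - ?a i'\<bar>)"
    unfolding sum_ennreal[OF abs_ge_zero] by (rule ennreal_mult) (auto intro: sum_nonneg)
  also have "\<dots> \<le> ennreal ?c * (\<Sum>i'\<in>{..<b} - {i}. ?X i')"
    by (rule mult_left_mono[OF sum_mono[OF le]]) simp
  finally show ?thesis .
qed

text \<open>Every unordered pair is met twice, as (i, i') and as (i', i). The 2 in the final
  constant comes from here.\<close>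

lemma sum_off_diagonal_symmetric:
  fixes G :: "nat \<Rightarrow> nat \<Rightarrow> 'a::comm_semiring_1"
  shows "(\<Sum>i<b. \<Sum>i'\<in>{..<b} - {i}. G (min i i') (max i i')) = 2 * (\<Sum>i<b. \<Sum>i'\<in>{i<..<b}. G i i')"
proof -
  have "(\<Sum>i'\<in>{..<b} - {i}. G (min i i') (max i i')) = (\<Sum>i'\<in>{i'. i' < b \<and> i' < i}. G i' i) + (\<Sum>i'\<in>{i<..<b}. G i i')"
    if "i < b" for i
  proof -
    have eq: "{..<b} - {i} = {i'. i' < b \<and> i' < i} \<union> {i<..<b}"
      using that by auto
    have "(\<Sum>i'\<in>{..<b} - {i}. G (min i i') (max i i'))
      = (\<Sum>i'\<in>{i'. i' < b \<and> i' < i}. G (min i i') (max i i')) + (\<Sum>i'\<in>{i<..<b}. G (min i i') (max i i'))"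
      unfolding eq by (rule sum.union_disjoint) auto
    also have "\<dots> = (\<Sum>i'\<in>{i'. i' < b \<and> i' < i}. G i' i) + (\<Sum>i'\<in>{i<..<b}. G i i')"
      by (intro arg_cong2[where f = "(+)"] sum.cong) auto
    finally show ?thesis .
  qed
  then have "(\<Sum>i<b. \<Sum>i'\<in>{..<b} - {i}. G (min i i') (max i i'))
     = (\<Sum>i<b. \<Sum>i'\<in>{i'. i' < b \<and> i' < i}. G i' i) + (\<Sum>i<b. \<Sum>i'\<in>{i<..<b}. G i i')"
    by (simp add: sum.distrib[symmetric])
  \<comment> \<open>Exchanging the sums over the lower triangle turns it into the upper one with the
    names swapped.\<close>
  also have "(\<Sum>i<b. \<Sum>i'\<in>{i'. i' < b \<and> i' < i}. G i' i) = (\<Sum>i'<b. \<Sum>i\<in>{i'<..<b}. G i' i)"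
    using sum.swap_restrict[of "{..<b}" "{..<b}" "\<lambda>i i'. G i' i" "\<lambda>i i'. i' < i"]
    by (simp add: greaterThanLessThan_def greaterThan_def lessThan_def Int_def conj_commute)
  finally show ?thesis
    by (simp only: mult_2)
qed

lemma Lp_norm_on_shift_le_omega:
  "0 < h \<Longrightarrow> h \<le> \<delta> \<Longrightarrow> Lp_norm_on p {0..1 - h} (\<lambda>x. f (x + h) - f x) \<le> omega p f \<delta>"
  unfolding omega_def by (rule SUP_upper) auto

text \<open>The cells are disjoint, and \<open>m + d < b ^ n\<close> keeps each of them inside the
  interval on which the difference with shift \<open>d\<close> is taken.\<close>

lemma sum_cells_le:
  assumes [measurable]: "F \<in> borel_measurable lebesgue" and "0 < b"
  shows "(\<Sum>m\<in>{m. m + d < b ^ n}. \<integral>\<^sup>+x\<in>cell b n m. F x \<partial>lebesgue)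
    \<le> (\<integral>\<^sup>+x\<in>{0..1 - real d / real b ^ n}. F x \<partial>lebesgue)"
proof -
  let ?A = "{m. m + d < b ^ n}"
  have fin: "finite ?A"
    by (rule finite_subset[of _ "{..<b ^ n}"]) auto
  have "(\<Sum>m\<in>?A. \<integral>\<^sup>+x\<in>cell b n m. F x \<partial>lebesgue) = (\<integral>\<^sup>+x. (\<Sum>m\<in>?A. F x * indicator (cell b n m) x) \<partial>lebesgue)"
    by (subst nn_integral_sum) auto
  also have "\<dots> = (\<integral>\<^sup>+x\<in>(\<Union>m\<in>?A. cell b n m). F x \<partial>lebesgue)"
    using fin disjoint_family_on_cell[OF assms(2)]
    by (simp add: sum_distrib_left[symmetric] indicator_UN_disjoint)
  also have "\<dots> \<le> (\<integral>\<^sup>+x\<in>{0..1 - real d / real b ^ n}. F x \<partial>lebesgue)"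
  proof (intro nn_integral_mono mult_left_mono)
    have "(\<Union>m\<in>?A. cell b n m) \<subseteq> {0..1 - real d / real b ^ n}"
      using cell_subset[OF assms(2)] by blast
    then show "indicator (\<Union>m\<in>?A. cell b n m) x \<le> (indicator {0..1 - real d / real b ^ n} x :: ennreal)" for x
      by (auto split: split_indicator)
  qed auto
  finally show ?thesis .
qed

subsection \<open>Level estimates\<close>

lemma sum_nat_blocks:
  fixes H :: "nat \<Rightarrow> 'a::comm_monoid_add"
  shows "(\<Sum>k<n. \<Sum>i<b. H (b * k + i)) = (\<Sum>m<n * b. H m)"
proof -
  have "(\<Sum>i<b. H (b * k + i)) = sum H {k * b..<k * b + b}" for k
    using sum.shift_bounds_nat_ivl[of H 0 "k * b" b]
    by (simp add: lessThan_atLeast0 add.commute mult.commute)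
  then show ?thesis
    by (simp add: sum.nat_group)
qed

text \<open>Each pair (position, shift) arises from at most two ordered pairs of siblings. There are
  \<open>b - 1\<close> shifts, and each contributes at most \<open>W\<close>.\<close>

lemma sum_same_block_pairs_le:
  fixes Y :: "nat \<Rightarrow> nat \<Rightarrow> ennreal"
  assumes W: "\<And>d. d \<in> {1..<b} \<Longrightarrow> (\<Sum>m\<in>{m. m + d < b ^ Suc n}. Y m d) \<le> W"
  shows "(\<Sum>k<b ^ n. \<Sum>i<b. \<Sum>i'\<in>{..<b} - {i}. Y (b * k + min i i') (max i i' - min i i'))
    \<le> 2 * (of_nat (b - 1) * W)"
proof -
  let ?N = "b ^ Suc n"
  \<comment> \<open>\<open>H\<close> forgets that \<open>m\<close> and \<open>m + d\<close> must
    have the same parent and keeps only that \<open>m + d\<close> is an admissible index. All terms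
    are nonnegative, so this only enlarges the sum.\<close>
  define H where "H m = (\<Sum>d\<in>{1..<b}. if m + d < ?N then Y m d else 0)" for m
  have row: "(\<Sum>i'\<in>{i<..<b}. Y (b * k + i) (i' - i)) \<le> H (b * k + i)" if "k < b ^ n" "i < b" for k i
  proof -
    have "(\<Sum>i'\<in>{i<..<b}. Y (b * k + i) (i' - i)) = (\<Sum>d\<in>{1..<b - i}. Y (b * k + i) d)"
      by (rule sum.reindex_bij_witness[where i = "\<lambda>d. i + d" and j = "\<lambda>i'. i' - i"]) auto
    also have "\<dots> = (\<Sum>d\<in>{1..<b - i}. if b * k + i + d < ?N then Y (b * k + i) d else 0)"
    proof (rule sum.cong)
      fix d assume "d \<in> {1..<b - i}"
      then have "b * k + (i + d) < ?N"
        by (intro block_index_less that) auto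
      then show "Y (b * k + i) d = (if b * k + i + d < ?N then Y (b * k + i) d else 0)"
        by (simp add: add.assoc)
    qed simp
    also have "\<dots> \<le> H (b * k + i)"
      unfolding H_def by (rule sum_mono2) auto
    finally show ?thesis .
  qed
  have "(\<Sum>k<b ^ n. \<Sum>i<b. \<Sum>i'\<in>{..<b} - {i}. Y (b * k + min i i') (max i i' - min i i'))
      = (\<Sum>k<b ^ n. 2 * (\<Sum>i<b. \<Sum>i'\<in>{i<..<b}. Y (b * k + i) (i' - i)))"
    by (intro sum.cong refl sum_off_diagonal_symmetric[where G = "\<lambda>i i'. Y (b * k + i) (i' - i)" for k])
  also have "\<dots> \<le> (\<Sum>k<b ^ n. 2 * (\<Sum>i<b. H (b * k + i)))"
    by (intro sum_mono mult_left_mono row) auto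
  also have "\<dots> = 2 * (\<Sum>m<?N. H m)"
    using sum_nat_blocks[of H b "b ^ n"] by (simp add: sum_distrib_left[symmetric] mult.commute)
  \<comment> \<open>With the shift outermost, the inner sum is the one that \<open>W\<close>
    bounds.\<close>
  also have "(\<Sum>m<?N. H m) = (\<Sum>d\<in>{1..<b}. \<Sum>m<?N. if m + d < ?N then Y m d else 0)"
    unfolding H_def by (rule sum.swap)
  also have "\<dots> = (\<Sum>d\<in>{1..<b}. \<Sum>m\<in>{m. m + d < ?N}. Y m d)"
  proof (rule sum.cong)
    fix d
    have "{m. m + d < ?N} = {m \<in> {..<?N}. m + d < ?N}" by auto
    then show "(\<Sum>m<?N. if m + d < ?N then Y m d else 0) = (\<Sum>m\<in>{m. m + d < ?N}. Y m d)"
      by (simp only: sum.inter_filter finite_lessThan)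
  qed simp
  also have "\<dots> \<le> (\<Sum>d\<in>{1..<b}. W)"
    by (intro sum_mono W)
  also have "\<dots> = of_nat (b - 1) * W"
    by simp
  finally show ?thesis
    by (simp add: mult_left_mono)
qed

text \<open>For finite p Jensen's inequality is used twice, over the siblings and over a cell, and
  then the pairs are counted. For p = \<infinity> each coefficient is bounded separately, in
  agreement with 2 powr 0 = 1. In the exponent of \<open>b\<close>, the part
  \<open>real (Suc n) / 2 - 1\<close> normalises the Haar function and the rest is Hoelder's factor
  for one cell.\<close>

lemma level_norm_Suc_le:
  assumes f: "integrable lebesgue f" and b: "2 \<le> b" and p: "1 \<le> p"
  shows "level_norm b p f (Suc n)
    \<le> ennreal (2 powr inv_exp p * (real b - 1) * real b powr (real (Suc n) / 2 - 1 - real (Suc n) * (1 - inv_exp p)))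
       * omega p f (real b powr - real n)"
    (is "_ \<le> _ * ?\<omega>")
proof -
  let ?N = "b ^ Suc n"
  define c where "c = real b powr (real (Suc n) / 2 - 1)"
  define D where "D d x = f (x + real d / real b ^ Suc n) - f x" for d x
  have b0: "0 < b" using b by simp
  have [measurable]: "f \<in> borel_measurable lebesgue"
    using f by auto
  have [measurable]: "D d \<in> borel_measurable lebesgue" for d
    unfolding D_def by (intro borel_measurable_diff borel_measurable_shift) auto
  \<comment> \<open>Siblings are fewer than \<open>b\<close> fine cells apart, so all shifts stay
    below the length of the parent and one modulus serves them all.\<close>
  have norm_le: "Lp_norm_on p {0..1 - real d / real b ^ Suc n} (D d) \<le> ?\<omega>" if "d \<in> {1..<b}" for d
  proof -
    have "real d / real b ^ Suc n \<le> real b / real b ^ Suc n"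
      using that by (intro divide_right_mono) auto
    also have "\<dots> = real b powr - real n"
      using b0 by (simp add: powr_minus powr_realpow field_simps)
    finally show ?thesis
      unfolding D_def using that b0 by (intro Lp_norm_on_shift_le_omega) auto
  qed
  have wc: "ennreal \<bar>wcoef b f (Suc n) i k\<bar> \<le> ennreal c * (\<Sum>i'\<in>{..<b} - {i}.
      \<integral>\<^sup>+x\<in>cell b (Suc n) (b * k + min i i'). ennreal \<bar>D (max i i' - min i i') x\<bar> \<partial>lebesgue)"
    if "k < b ^ n" "i < b" for k i
    unfolding c_def D_def by (rule wcoef_Suc_le[OF f b0 that])
  have diff: "max i i' - min i i' \<in> {1..<b}" if "i < b" "i' \<in> {..<b} - {i}" for i i'
    using that by (auto simp: max_def min_def)
  have card: "card ({..<b} - {i}) = b - 1" if "i < b" for i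
    using that by simp
  have KI: "Kset b (Suc n) = {..<b ^ n}" "Iset b (Suc n) = {..<b}"
    by (auto simp: Kset_def Iset_def)
  have s: "emeasure lebesgue (cell b (Suc n) m) = ennreal (1 / real b ^ Suc n)" for m
    by (rule emeasure_cell[OF b0])
  have s0: "0 < 1 / real b ^ Suc n"
    using b0 by simp
  have s_powr: "1 / real b ^ Suc n = real b powr - real (Suc n)"
    using b0 by (simp add: powr_minus powr_realpow field_simps del: power_Suc of_nat_Suc)
  show ?thesis
  proof (cases "p = \<infinity>")
    case True
    have "ennreal \<bar>wcoef b f (Suc n) i k\<bar> \<le> ennreal (c * (real b - 1) * real b powr - real (Suc n)) * ?\<omega>"
      if ki: "k < b ^ n" "i < b" for k i
    proof -
      have "(\<integral>\<^sup>+x\<in>cell b (Suc n) (b * k + min i i'). ennreal \<bar>D (max i i' - min i i') x\<bar> \<partial>lebesgue)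
          \<le> ennreal (real b powr - real (Suc n)) * ?\<omega>" if i': "i' \<in> {..<b} - {i}" for i'
      proof -
        let ?m = "b * k + min i i'" and ?d = "max i i' - min i i'"
        have "?m + ?d = b * k + max i i'" by auto
        also have "\<dots> < ?N"
          using ki i' by (intro block_index_less) auto
        finally have sub: "cell b (Suc n) ?m \<subseteq> {0..1 - real ?d / real b ^ Suc n}"
          by (intro cell_subset b0)
        have "(\<integral>\<^sup>+x\<in>cell b (Suc n) ?m. ennreal \<bar>D ?d x\<bar> \<partial>lebesgue)
            \<le> ennreal ((1 / real b ^ Suc n) powr (1 - inv_exp p)) * Lp_norm_on p (cell b (Suc n) ?m) (D ?d)"
          by (rule nn_integral_le_Lp_norm_on[OF _ _ s s0 p]) auto
        also have "\<dots> \<le> ennreal ((1 / real b ^ Suc n) powr (1 - inv_exp p)) * ?\<omega>"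
          by (intro mult_left_mono order_trans[OF Lp_norm_on_mono_set[OF sub] norm_le] diff ki i') auto
        finally show ?thesis
          using True s0 by (simp add: inv_exp_def s_powr del: power_Suc of_nat_Suc)
      qed
      then have "(\<Sum>i'\<in>{..<b} - {i}. \<integral>\<^sup>+x\<in>cell b (Suc n) (b * k + min i i'). ennreal \<bar>D (max i i' - min i i') x\<bar> \<partial>lebesgue)
          \<le> of_nat (b - 1) * (ennreal (real b powr - real (Suc n)) * ?\<omega>)"
        unfolding card[OF ki(2), symmetric] by (rule sum_bounded_above)
      then have "ennreal \<bar>wcoef b f (Suc n) i k\<bar> \<le> ennreal c * (of_nat (b - 1) * (ennreal (real b powr - real (Suc n)) * ?\<omega>))"
        using wc[OF ki] by (meson mult_left_mono order_trans zero_le)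
      also have "\<dots> = ennreal (c * (real b - 1) * real b powr - real (Suc n)) * ?\<omega>"
        using b by (simp add: ennreal_mult c_def ennreal_of_nat_eq_real_of_nat of_nat_diff mult.assoc)
      finally show ?thesis .
    qed
    then have "level_norm b p f (Suc n) \<le> ennreal (c * (real b - 1) * real b powr - real (Suc n)) * ?\<omega>"
      unfolding level_norm_def KI using True by (auto intro!: SUP_least)
    also have "c * (real b - 1) * real b powr - real (Suc n)
        = 2 powr inv_exp p * (real b - 1) * real b powr (real (Suc n) / 2 - 1 - real (Suc n) * (1 - inv_exp p))"
    proof -
      have "c * real b powr - real (Suc n) = real b powr (real (Suc n) / 2 - 1 - real (Suc n) * (1 - inv_exp p))"
        using True by (simp add: c_def inv_exp_def powr_add[symmetric] del: of_nat_Suc)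
      then show ?thesis
        using True b0 by (simp add: inv_exp_def mult.commute mult.left_commute del: of_nat_Suc)
    qed
    finally show ?thesis .
  next
    case False
    define r where "r = enn2real p"
    have r: "1 \<le> r" using one_le_enn2real[OF p False] by (simp add: r_def)
    have ie: "inv_exp p = 1 / r" using False by (simp add: inv_exp_def r_def)
    \<comment> \<open>The r-th powers are kept inside the integral, so that contributions of
      disjoint cells add up.\<close>
    define Y where "Y m d = (\<integral>\<^sup>+x\<in>cell b (Suc n) m. epow (ennreal \<bar>D d x\<bar>) r \<partial>lebesgue)" for m d
    \<comment> \<open>The three factors come from the Haar normalisation, from Jensen over the
      \<open>b - 1\<close> siblings and from Jensen over the cell.\<close>
    define C where "C = c powr r * (real b - 1) powr (r - 1) * (1 / real b ^ Suc n) powr (r - 1)"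
    have cell_le: "epow (\<integral>\<^sup>+x\<in>cell b (Suc n) m. ennreal \<bar>D d x\<bar> \<partial>lebesgue) r
        \<le> ennreal ((1 / real b ^ Suc n) powr (r - 1)) * Y m d" for m d
    proof -
      have "emeasure (lebesgue_on (cell b (Suc n) m)) (space (lebesgue_on (cell b (Suc n) m))) = ennreal (1 / real b ^ Suc n)"
        using s by (simp add: emeasure_restrict_space)
      from nn_integral_power_mean[OF _ this s0 r, of "\<lambda>x. ennreal \<bar>D d x\<bar>"]
      show ?thesis
        unfolding Y_def by (simp add: nn_integral_restrict_space measurable_restrict_space1)
    qed
    have "epow (ennreal \<bar>wcoef b f (Suc n) i k\<bar>) r
        \<le> ennreal C * (\<Sum>i'\<in>{..<b} - {i}. Y (b * k + min i i') (max i i' - min i i'))"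
      if ki: "k < b ^ n" "i < b" for k i
    proof -
      let ?I = "{..<b} - {i}"
      let ?X = "\<lambda>i'. \<integral>\<^sup>+x\<in>cell b (Suc n) (b * k + min i i'). ennreal \<bar>D (max i i' - min i i') x\<bar> \<partial>lebesgue"
      have ne: "?I \<noteq> {}"
        using card[OF ki(2)] b by (metis card.empty diff_is_0_eq not_less_eq_eq numeral_2_eq_2 One_nat_def)
      have "epow (ennreal \<bar>wcoef b f (Suc n) i k\<bar>) r \<le> epow (ennreal c * (\<Sum>i'\<in>?I. ?X i')) r"
        using r by (intro epow_mono wc ki) auto
      also have "\<dots> = ennreal (c powr r) * epow (\<Sum>i'\<in>?I. ?X i') r"
        using r by (simp add: epow_mult epow_ennreal c_def)
      also have "\<dots> \<le> ennreal (c powr r) * (ennreal (real (b - 1) powr (r - 1)) * (\<Sum>i'\<in>?I. epow (?X i') r))"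
        using sum_power_mean[of ?I r ?X] ne r ki by (intro mult_left_mono) auto
      also have "\<dots> \<le> ennreal (c powr r) * (ennreal (real (b - 1) powr (r - 1)) *
          (\<Sum>i'\<in>?I. ennreal ((1 / real b ^ Suc n) powr (r - 1)) * Y (b * k + min i i') (max i i' - min i i')))"
        by (intro mult_left_mono sum_mono cell_le) auto
      also have "\<dots> = ennreal C * (\<Sum>i'\<in>?I. Y (b * k + min i i') (max i i' - min i i'))"
        using b by (simp add: C_def sum_distrib_left[symmetric] ennreal_mult of_nat_diff mult.assoc)
      finally show ?thesis .
    qed
    then have "(\<Sum>k<b ^ n. \<Sum>i<b. epow (ennreal \<bar>wcoef b f (Suc n) i k\<bar>) r)
        \<le> (\<Sum>k<b ^ n. \<Sum>i<b. ennreal C * (\<Sum>i'\<in>{..<b} - {i}. Y (b * k + min i i') (max i i' - min i i')))"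
      by (intro sum_mono) auto
    also have "\<dots> = ennreal C * (\<Sum>k<b ^ n. \<Sum>i<b. \<Sum>i'\<in>{..<b} - {i}. Y (b * k + min i i') (max i i' - min i i'))"
      by (simp add: sum_distrib_left)
    \<comment> \<open>For a fixed shift the cell integrals fit into \<open>{0..1 - h}\<close>, where
      they are bounded by the r-th power of the norm of the difference; hence \<open>W\<close> is
      the r-th power of the modulus.\<close>
    also have "\<dots> \<le> ennreal C * (2 * (of_nat (b - 1) * epow ?\<omega> r))"
    proof (intro mult_left_mono sum_same_block_pairs_le)
      fix d assume d: "d \<in> {1..<b}"
      have "(\<Sum>m\<in>{m. m + d < ?N}. Y m d) \<le> (\<integral>\<^sup>+x\<in>{0..1 - real d / real b ^ Suc n}. epow (ennreal \<bar>D d x\<bar>) r \<partial>lebesgue)"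
        unfolding Y_def by (rule sum_cells_le[OF _ b0]) measurable
      also have "\<dots> = epow (Lp_norm_on p {0..1 - real d / real b ^ Suc n} (D d)) r"
        using False r by (simp add: Lp_norm_on_def epow_epow flip: r_def)
      also have "\<dots> \<le> epow ?\<omega> r"
        using r by (intro epow_mono norm_le d) auto
      finally show "(\<Sum>m\<in>{m. m + d < ?N}. Y m d) \<le> epow ?\<omega> r" .
    qed simp
    also have "\<dots> = ennreal (C * 2 * (real b - 1)) * epow ?\<omega> r"
    proof -
      have "of_nat (b - 1) = ennreal (real b - 1)"
        using b by (simp add: ennreal_of_nat_eq_real_of_nat of_nat_diff)
      moreover have "ennreal (C * 2 * (real b - 1)) = ennreal C * ennreal 2 * ennreal (real b - 1)"
        using b ennreal_mult[of "C * 2" "real b - 1"] ennreal_mult[of C 2] by (simp add: C_def)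
      ultimately show ?thesis
        by (simp add: mult.assoc)
    qed
    finally have "epow (\<Sum>k<b ^ n. \<Sum>i<b. epow (ennreal \<bar>wcoef b f (Suc n) i k\<bar>) r) (1 / r)
      \<le> epow (ennreal (C * 2 * (real b - 1)) * epow ?\<omega> r) (1 / r)"
      using r by (intro epow_mono) auto
    also have "\<dots> = ennreal ((C * 2 * (real b - 1)) powr (1 / r)) * ?\<omega>"
      using r b by (simp add: epow_mult epow_epow epow_ennreal C_def)
    also have "(C * 2 * (real b - 1)) powr (1 / r) = 2 powr inv_exp p * (real b - 1)
        * real b powr (real (Suc n) / 2 - 1 - real (Suc n) * (1 - inv_exp p))"
    proof -
      \<comment> \<open>The number of shifts supplies the power of \<open>b - 1\<close> missing
        after Jensen's inequality, so the r-th root yields exactly \<open>b - 1\<close>.\<close>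
      have powr_r: "(real b - 1) powr (r - 1) * (real b - 1) = (real b - 1) powr r"
        using b by (simp add: powr_diff)
      have "C * 2 * (real b - 1) = 2 * (real b - 1) powr r * c powr r * real b powr (- real (Suc n) * (r - 1))"
        unfolding C_def s_powr powr_powr powr_r[symmetric] by (simp only: mult_ac)
      also have "\<dots> powr (1 / r) = 2 powr (1 / r) * (real b - 1) * c * real b powr (- real (Suc n) * (r - 1) / r)"
        using b r by (simp add: powr_mult powr_powr c_def)
      also have "\<dots> = 2 powr inv_exp p * (real b - 1)
        * real b powr (real (Suc n) / 2 - 1 - real (Suc n) * (1 - inv_exp p))"
      proof -
        have "(- real (Suc n) * (r - 1) / r) = - real (Suc n) * (1 - inv_exp p)"
          using r unfolding ie by (simp add: field_simps)
        then show ?thesis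
          unfolding c_def ie by (simp add: powr_add[symmetric] mult.assoc del: of_nat_Suc)
      qed
      finally show ?thesis .
    qed
    finally show ?thesis
      using False unfolding level_norm_def KI r_def[symmetric] by (simp add: epow_ennreal)
  qed
qed

subsection \<open>Comparison of the norms\<close>

text \<open>The only coefficient is the integral over \<open>{0..<1}\<close>, and Hoelder's
  inequality on a set of measure 1 has constant 1.\<close>

lemma level_norm_0_le:
  assumes f: "integrable lebesgue f" and p: "1 \<le> p"
  shows "level_norm b p f 0 \<le> Lp_norm_on p {0..1} f"
proof -
  have [measurable]: "f \<in> borel_measurable lebesgue"
    using f by auto
  have level: "level_norm b p f 0 = ennreal \<bar>wcoef b f 0 0 0\<bar>"
  proof (cases "p = \<infinity>")
    case False
    then have "1 \<le> enn2real p"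
      using one_le_enn2real p by blast
    then show ?thesis
      using False by (simp add: level_norm_def Kset_def Iset_def epow_ennreal powr_powr)
  qed (simp add: level_norm_def Kset_def Iset_def)
  have "wcoef b f 0 0 0 = (\<integral>x. indicator {0..<1} x *\<^sub>R f x \<partial>lebesgue)"
    unfolding wcoef_def set_lebesgue_integral_def
    by (intro Bochner_Integration.integral_cong) (auto simp: haar_def split: split_indicator)
  then have "ennreal \<bar>wcoef b f 0 0 0\<bar> \<le> (\<integral>\<^sup>+x. ennreal (norm (indicator {0..<1} x *\<^sub>R f x)) \<partial>lebesgue)"
    using integral_norm_bound_ennreal[OF integrable_mult_indicator[OF _ f, of "{0..<1}"]] by simp
  also have "\<dots> \<le> (\<integral>\<^sup>+x\<in>{0..1}. ennreal \<bar>f x\<bar> \<partial>lebesgue)"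
    by (intro nn_integral_mono) (auto split: split_indicator)
  also have "\<dots> \<le> ennreal (1 powr (1 - inv_exp p)) * Lp_norm_on p {0..1} f"
    by (intro nn_integral_le_Lp_norm_on p) auto
  finally show ?thesis
    by (simp add: level)
qed

text \<open>A level has finitely many real coefficients. This settles levels 0 and 1, which the
  discretised Besov integral below does not reach.\<close>

lemma level_norm_less_top: "level_norm b p f j < \<infinity>"
proof (cases "p = \<infinity>")
  case True
  have fin: "finite (Kset b j \<times> Iset b j)"
    by (auto simp: Kset_def Iset_def)
  have "level_norm b p f j \<le> (\<Sum>(k, i)\<in>Kset b j \<times> Iset b j. ennreal \<bar>wcoef b f j i k\<bar>)"
    using True fin unfolding level_norm_def
    by (auto intro!: SUP_least member_le_sum[where f = "\<lambda>(k, i). ennreal \<bar>wcoef b f j i k\<bar>", THEN order_trans[rotated]])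
  also have "\<dots> < \<infinity>"
    using fin by (auto simp: case_prod_beta)
  finally show ?thesis .
qed (auto simp: level_norm_def Kset_def Iset_def)

text \<open>The powers of \<open>b\<close> combine to exponent \<alpha>(n + 1) - 1, where 1/p
  cancels. The factor 1/b turns \<open>b - 1\<close> into 1 - 1/b, and the step from n + 1 to n
  costs \<open>real b powr \<alpha>\<close>.\<close>

lemma weighted_level_norm_Suc_le:
  assumes "integrable lebesgue f" "2 \<le> b" "1 \<le> p"
  shows "ennreal (real b powr ((\<alpha> - inv_exp p + 1/2) * real (Suc n))) * level_norm b p f (Suc n)
    \<le> ennreal (2 powr inv_exp p * (1 - 1 / real b) * real b powr \<alpha>)
       * (ennreal (real b powr (real n * \<alpha>)) * omega p f (real b powr - real n))"
    (is "ennreal ?w * _ \<le> ennreal ?K * (ennreal ?v * ?\<omega>)")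
proof -
  let ?c = "2 powr inv_exp p * (real b - 1) * real b powr (real (Suc n) / 2 - 1 - real (Suc n) * (1 - inv_exp p))"
  have "ennreal ?w * level_norm b p f (Suc n) \<le> ennreal ?w * (ennreal ?c * ?\<omega>)"
    by (intro mult_left_mono level_norm_Suc_le assms) auto
  also have "\<dots> = ennreal (?w * ?c) * ?\<omega>"
    using assms by (simp add: ennreal_mult mult.assoc)
  also have "?w * ?c = ?K * ?v"
  proof -
    let ?e = "real (Suc n) / 2 - 1 - real (Suc n) * (1 - inv_exp p)"
    have "(\<alpha> - inv_exp p + 1/2) * real (Suc n) + ?e = (\<alpha> + real n * \<alpha>) + (- 1)"
      by (simp add: field_simps)
    then have "?w * real b powr ?e = real b powr \<alpha> * ?v * real b powr (- 1)"
      unfolding powr_add[symmetric] by simp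
    also have "real b powr (- 1) = 1 / real b"
      using assms by (simp add: powr_minus_divide)
    finally have "?w * ?c = 2 powr inv_exp p * (real b - 1) * (real b powr \<alpha> * ?v * (1 / real b))"
      by (simp add: mult.assoc mult.left_commute)
    then show ?thesis
      using assms by (simp add: field_simps)
  qed
  also have "ennreal (?K * ?v) * ?\<omega> = ennreal ?K * (ennreal ?v * ?\<omega>)"
    using assms by (simp add: ennreal_mult mult.assoc)
  finally show ?thesis .
qed

lemma suminf_ennreal_Suc: "(\<Sum>n. f n) = f 0 + (\<Sum>n. f (Suc n))" for f :: "nat \<Rightarrow> ennreal"
proof -
  have "(\<lambda>n. f (Suc n)) sums (\<Sum>n. f (Suc n))"
    by (simp add: summable_sums)
  from sums_Suc[OF this] show ?thesis
    by (simp add: sums_iff add.commute)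
qed

text \<open>Level 0 is bounded by the norm of \<open>f\<close>, and level \<open>Suc n\<close> by
  \<open>K\<close> times the n-th weighted modulus. For q = \<infinity> the supremum is at most the
  sum of the two bounds; for finite q superadditivity of the power \<open>s\<close> merges
  them.\<close>

lemma wav_norm_le_besov_norm_b:
  assumes f: "integrable lebesgue f" and b: "2 \<le> b" and p: "1 \<le> p" and q: "1 \<le> q"
  shows "wav_norm b \<alpha> p q f
    \<le> ennreal (max 1 (2 powr (inv_exp p) * (1 - 1 / real b) * real b powr \<alpha>)) * besov_norm_b b \<alpha> p q f"
proof -
  define K where "K = 2 powr (inv_exp p) * (1 - 1 / real b) * real b powr \<alpha>"
  define L where "L = Lp_norm_on p {0..1} f"
  define a where "a n = ennreal (real b powr (real n * \<alpha>)) * omega p f (real b powr (- real n))" for n :: nat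
  define t where "t j = ennreal (real b powr ((\<alpha> - inv_exp p + 1/2) * real j)) * level_norm b p f j" for j
  have t0: "t 0 \<le> L"
    using level_norm_0_le[OF f p, of b] b by (simp add: t_def L_def)
  have tSuc: "t (Suc n) \<le> ennreal K * a n" for n
    unfolding t_def K_def a_def by (rule weighted_level_norm_Suc_le[OF f b p])
  \<comment> \<open>Both parts are enlarged to a common factor, which is where the maximum with 1
    arises.\<close>
  have *: "L + ennreal K * V \<le> ennreal (max 1 K) * (L + V)" for V
  proof -
    have "1 * L + ennreal K * V \<le> ennreal (max 1 K) * L + ennreal (max 1 K) * V"
      by (intro add_mono mult_right_mono) (auto simp: ennreal_leI simp flip: ennreal_1)
    then show ?thesis
      by (simp add: distrib_left)
  qed
  show ?thesis
  proof (cases "q = \<infinity>")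
    case True
    have "(SUP j. t j) \<le> L + ennreal K * (SUP n. a n)"
    proof (rule SUP_least)
      fix j
      show "t j \<le> L + ennreal K * (SUP n. a n)"
      proof (cases j)
        case 0
        then show ?thesis using t0 by (simp add: add_increasing2)
      next
        case (Suc n)
        have "t j \<le> ennreal K * (SUP n. a n)"
          unfolding Suc by (rule order_trans[OF tSuc mult_left_mono]) (auto intro: SUP_upper)
        then show ?thesis by (simp add: add_increasing)
      qed
    qed
    also note *
    finally show ?thesis
      using True by (simp add: wav_norm_def besov_norm_b_def t_def a_def L_def K_def)
  next
    case False
    define s where "s = enn2real q"
    have s: "1 \<le> s" using one_le_enn2real[OF q False] by (simp add: s_def)
    define V where "V = epow (\<Sum>n. epow (a n) s) (1 / s)"
    have "(\<Sum>j. epow (t j) s) = epow (t 0) s + (\<Sum>n. epow (t (Suc n)) s)"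
      by (rule suminf_ennreal_Suc)
    also have "\<dots> \<le> epow L s + (\<Sum>n. epow (ennreal K) s * epow (a n) s)"
      using s t0 tSuc by (intro add_mono suminf_le) (auto simp: epow_mult[symmetric] intro!: epow_mono)
    also have "\<dots> = epow L s + epow (ennreal K * V) s"
      using s by (simp add: V_def epow_mult epow_epow)
    also have "\<dots> \<le> epow (L + ennreal K * V) s"
      by (rule epow_add_le[OF s])
    finally have "epow (\<Sum>j. epow (t j) s) (1 / s) \<le> epow (epow (L + ennreal K * V) s) (1 / s)"
      using s by (intro epow_mono) auto
    also have "\<dots> = L + ennreal K * V"
      using s by (simp add: epow_epow)
    also note *
    finally show ?thesis
      using False by (simp add: wav_norm_def besov_norm_b_def t_def a_def L_def K_def V_def s_def)
  qed
qed

section \<open>Discretisation of the Besov integral over b-adic ranges of the step size\<close>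

lemma omega_mono: "\<delta> \<le> \<delta>' \<Longrightarrow> omega p f \<delta> \<le> omega p f \<delta>'"
  unfolding omega_def by (rule SUP_subset_mono) auto

text \<open>The weight is smallest at the right endpoint of the interval and the modulus at the left
  one. Comparing the two endpoints costs the factor \<open>real b powr - \<alpha>\<close>.\<close>

lemma powr_interval_term_le:
  assumes b: "2 \<le> b" and \<alpha>: "0 < \<alpha>"
    and t: "t \<in> {real b powr - real (Suc n)<..real b powr - real n}"
  shows "ennreal (real b powr - \<alpha>) * (ennreal (real b powr (real (Suc n) * \<alpha>)) * omega p f (real b powr - real (Suc n)))
    \<le> ennreal (t powr - \<alpha>) * omega p f t"
proof -
  have "0 < t" using t by (auto intro: le_less_trans[OF powr_ge_zero])
  have "(real b powr - real n) powr - \<alpha> \<le> t powr - \<alpha>"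
    using t \<open>0 < t\<close> \<alpha> by (intro powr_mono2') auto
  moreover have "real b powr - \<alpha> * real b powr (real (Suc n) * \<alpha>) = (real b powr - real n) powr - \<alpha>"
    by (simp add: powr_powr powr_add[symmetric] algebra_simps)
  ultimately have "ennreal (real b powr - \<alpha>) * ennreal (real b powr (real (Suc n) * \<alpha>)) \<le> ennreal (t powr - \<alpha>)"
    by (simp add: ennreal_mult[symmetric] ennreal_leI)
  moreover have "omega p f (real b powr - real (Suc n)) \<le> omega p f t"
    using t by (intro omega_mono) auto
  ultimately show ?thesis
    unfolding mult.assoc[symmetric] by (intro mult_mono) auto
qed

lemma disjoint_powr_intervals:
  assumes "2 \<le> b"
  shows "disjoint_family (\<lambda>n. {real b powr - real (Suc n)<..real b powr - real n})"
proof -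
  have "{real b powr - real (Suc m)<..real b powr - real m} \<inter> {real b powr - real (Suc n)<..real b powr - real n} = {}"
    if "m < n" for m n
  proof -
    have "real b powr - real n \<le> real b powr - real (Suc m)"
      using assms that by (intro powr_mono) auto
    then show ?thesis by auto
  qed
  then show ?thesis
    unfolding disjoint_family_on_def by (metis Int_commute linorder_neqE_nat)
qed

lemma emeasure_powr_interval:
  assumes "2 \<le> b"
  shows "emeasure lebesgue {real b powr - real (Suc n)<..real b powr - real n} = ennreal ((1 - 1 / real b) * real b powr - real n)"
proof -
  have "real b powr - real (Suc n) = real b powr - real n * (1 / real b)"
    using assms by (simp add: powr_diff powr_minus_divide)
  then have "real b powr - real n - real b powr - real (Suc n) = (1 - 1 / real b) * real b powr - real n"
    by (simp add: algebra_simps)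
  moreover have "real b powr - real (Suc n) \<le> real b powr - real n"
    using assms by (intro powr_mono) auto
  ultimately show ?thesis
    by simp
qed

text \<open>Every b-adic interval has positive measure, so it contains a point at which the
  essential bound holds, and monotonicity carries the bound to the left endpoint. The left endpoints
  are the scales with exponent \<open>Suc n\<close>.\<close>

lemma besov_weighted_omega_bounded:
  assumes b: "2 \<le> b" and \<alpha>: "0 < \<alpha>" and fin: "besov_norm \<alpha> p \<infinity> f < \<infinity>"
  obtains M where "0 \<le> M"
    "\<And>n. ennreal (real b powr (real (Suc n) * \<alpha>)) * omega p f (real b powr - real (Suc n)) \<le> ennreal M"
proof -
  define E where "E = esssup (lebesgue_on {0<..1}) (\<lambda>t. ennreal (t powr (-\<alpha>)) * omega p f t)"
  have "E < \<infinity>"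
    using fin by (auto simp: besov_norm_def E_def)
  then obtain e where e: "E = ennreal e" "0 \<le> e"
    by (cases E) auto
  have bound: "ennreal (real b powr (real (Suc n) * \<alpha>)) * omega p f (real b powr - real (Suc n)) \<le> ennreal (real b powr \<alpha> * e)"
    (is "?a \<le> _") for n
  proof -
    let ?A = "{real b powr - real (Suc n)<..real b powr - real n}"
    have sub: "?A \<subseteq> {0<..1}"
    proof -
      have "real b powr - real n \<le> real b powr 0"
        using b by (intro powr_mono) auto
      then show ?thesis
        using b by (auto intro: le_less_trans[OF powr_ge_zero])
    qed
    have AE: "AE t in lebesgue. t \<in> {0<..1} \<longrightarrow> ennreal (t powr (-\<alpha>)) * omega p f t \<le> E"
      using esssup_AE[of "\<lambda>t. ennreal (t powr (-\<alpha>)) * omega p f t" "lebesgue_on {0<..1}"]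
      by (simp add: AE_restrict_space_iff E_def)
    have "\<exists>t\<in>?A. ennreal (t powr (-\<alpha>)) * omega p f t \<le> E"
    \<comment> \<open>If the bound failed on the whole interval, the interval would be a null
      set.\<close>
    proof (rule ccontr)
      assume "\<not> ?thesis"
      with AE sub have "AE t in lebesgue. t \<notin> ?A"
        by (auto elim!: eventually_mono)
      then have "emeasure lebesgue ?A = 0"
        using AE_iff_null_sets[of ?A lebesgue] by auto
      moreover have "0 < (1 - 1 / real b) * real b powr - real n"
        using b by simp
      ultimately show False
        unfolding emeasure_powr_interval[OF b] by (simp only: ennreal_eq_0_iff)
    qed
    then obtain t where "t \<in> ?A" "ennreal (t powr (-\<alpha>)) * omega p f t \<le> E" by blast
    then have "ennreal (real b powr - \<alpha>) * ?a \<le> ennreal e"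
      using powr_interval_term_le[OF b \<alpha>] e(1) order_trans by blast
    then have "ennreal (real b powr \<alpha>) * (ennreal (real b powr - \<alpha>) * ?a) \<le> ennreal (real b powr \<alpha>) * ennreal e"
      by (intro mult_left_mono) auto
    moreover have "ennreal (real b powr \<alpha>) * ennreal (real b powr - \<alpha>) = 1"
      using b by (simp add: ennreal_mult[symmetric] powr_add[symmetric])
    ultimately show ?thesis
      by (simp add: mult.assoc[symmetric] ennreal_mult e)
  qed
  show ?thesis
    by (rule that[OF _ bound]) (simp add: e)
qed

text \<open>The integrand is minorised by a step function constant on the b-adic intervals. Each
  interval has measure 1 - 1/b with respect to dt/t replaced by its lower bound, so the integral of
  the step function is a fixed positive multiple of the series.\<close>

lemma besov_weighted_omega_summable:
  assumes b: "2 \<le> b" and \<alpha>: "0 < \<alpha>" and q: "1 \<le> q" "q \<noteq> \<infinity>" and fin: "besov_norm \<alpha> p q f < \<infinity>"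
  shows "(\<Sum>n. epow (ennreal (real b powr (real (Suc n) * \<alpha>)) * omega p f (real b powr - real (Suc n))) (enn2real q)) < \<infinity>"
proof -
  define s where "s = enn2real q"
  have s: "1 \<le> s" using one_le_enn2real[OF q] by (simp add: s_def)
  define a where "a n = ennreal (real b powr (real (Suc n) * \<alpha>)) * omega p f (real b powr - real (Suc n))" for n
  define A where "A n = {real b powr - real (Suc n)<..real b powr - real n}" for n
  \<comment> \<open>The value of the minorant on \<open>A n\<close>; the last factor is the least
    value of 1/t there.\<close>
  define c where "c n = epow (ennreal (real b powr - \<alpha>) * a n) s * ennreal (real b powr real n)" for n
  let ?F = "\<lambda>t. epow (ennreal (t powr (-\<alpha>)) * omega p f t) s * ennreal (1 / t)"
  have disj: "disjoint_family A"
    unfolding A_def by (rule disjoint_powr_intervals[OF b])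
  have [measurable]: "A n \<in> sets lebesgue" for n
    unfolding A_def by simp
  have pw: "(\<Sum>n. c n * indicator (A n) t) \<le> ?F t * indicator {0<..1} t" for t
  proof (cases "\<exists>n. t \<in> A n")
    case True
    then obtain n where n: "t \<in> A n" by blast
    have "real b powr - real n \<le> real b powr 0"
      using b by (intro powr_mono) auto
    then have t: "0 < t" "t \<le> 1" "t \<le> real b powr - real n"
      using n b by (auto simp: A_def intro: le_less_trans[OF powr_ge_zero])
    have "1 / (real b powr - real n) \<le> 1 / t"
      using t b by (intro divide_left_mono) auto
    then have "real b powr real n \<le> 1 / t"
      by (simp add: powr_minus_divide)
    then have "c n \<le> ?F t"
      unfolding c_def a_def using s n b \<alpha>
      by (intro mult_mono epow_mono powr_interval_term_le[OF b \<alpha>] ennreal_leI) (auto simp: A_def)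
    moreover have "(\<Sum>n. c n * indicator (A n) t) = c n"
      by (rule suminf_cmult_indicator[OF disj n])
    ultimately show ?thesis
      using t by simp
  qed (auto simp: indicator_def)
  have "ennreal (1 - 1 / real b) * (epow (ennreal (real b powr - \<alpha>)) s * (\<Sum>n. epow (a n) s))
      = (\<Sum>n. ennreal (1 - 1 / real b) * (epow (ennreal (real b powr - \<alpha>)) s * epow (a n) s))"
    by simp
  also have "\<dots> = (\<Sum>n. \<integral>\<^sup>+t. c n * indicator (A n) t \<partial>lebesgue)"
  proof (rule suminf_cong)
    fix n
    \<comment> \<open>The factor \<open>real b powr real n\<close> cancels the length of the
      interval up to 1 - 1/b, independently of \<open>n\<close>.\<close>
    have "(\<integral>\<^sup>+t. c n * indicator (A n) t \<partial>lebesgue) = c n * ennreal ((1 - 1 / real b) * real b powr - real n)"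
      unfolding emeasure_powr_interval[OF b, symmetric] A_def[symmetric] by (rule nn_integral_cmult_indicator) simp
    also have "\<dots> = ennreal (1 - 1 / real b) * epow (ennreal (real b powr - \<alpha>) * a n) s
        * (ennreal (real b powr real n) * ennreal (real b powr - real n))"
      using b by (simp add: c_def ennreal_mult mult_ac)
    also have "ennreal (real b powr real n) * ennreal (real b powr - real n) = 1"
      using b by (simp add: ennreal_mult[symmetric] powr_add[symmetric])
    finally show "ennreal (1 - 1 / real b) * (epow (ennreal (real b powr - \<alpha>)) s * epow (a n) s)
        = (\<integral>\<^sup>+t. c n * indicator (A n) t \<partial>lebesgue)"
      using s by (simp add: epow_mult)
  qed
  also have "\<dots> = (\<integral>\<^sup>+t. (\<Sum>n. c n * indicator (A n) t) \<partial>lebesgue)"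
    by (rule nn_integral_suminf[symmetric]) simp
  also have "\<dots> \<le> (\<integral>\<^sup>+t. ?F t * indicator {0<..1} t \<partial>lebesgue)"
    by (rule nn_integral_mono) (rule pw)
  also have "\<dots> < \<infinity>"
    using fin q by (auto simp: besov_norm_def s_def)
  finally have "epow (ennreal (real b powr - \<alpha>)) s * (\<Sum>n. epow (a n) s) < \<infinity>"
    using b by (auto simp: ennreal_mult_less_top)
  then show ?thesis
    using b by (auto simp: ennreal_mult_less_top epow_ennreal a_def s_def)
qed

text \<open>Levels from 2 on are controlled by the weighted moduli at the scales with exponent
  \<open>Suc n\<close>, which the Besov integral bounds. Levels 0 and 1 are split off as single
  finite terms.\<close>

lemma wav_norm_less_top:
  assumes f: "integrable lebesgue f" and b: "2 \<le> b" and \<alpha>: "0 < \<alpha>" and p: "1 \<le> p" and q: "1 \<le> q"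
    and fin: "besov_norm \<alpha> p q f < \<infinity>"
  shows "wav_norm b \<alpha> p q f < \<infinity>"
proof -
  define K where "K = 2 powr (inv_exp p) * (1 - 1 / real b) * real b powr \<alpha>"
  define a where "a n = ennreal (real b powr (real n * \<alpha>)) * omega p f (real b powr (- real n))" for n :: nat
  define t where "t j = ennreal (real b powr ((\<alpha> - inv_exp p + 1/2) * real j)) * level_norm b p f j" for j
  have tSuc: "t (Suc n) \<le> ennreal K * a n" for n
    unfolding t_def K_def a_def by (rule weighted_level_norm_Suc_le[OF f b p])
  have tfin: "t j < \<infinity>" for j
    using level_norm_less_top[of b p f j] by (simp add: t_def ennreal_mult_less_top)
  show ?thesis
  proof (cases "q = \<infinity>")
    case True
    obtain M where M: "\<And>n. a (Suc n) \<le> ennreal M"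
      using besov_weighted_omega_bounded[OF b \<alpha>, of p f] fin True unfolding a_def by metis
    have "(SUP j. t j) \<le> t 0 + t 1 + ennreal K * ennreal M"
    proof (rule SUP_least)
      fix j
      consider "j = 0" | "j = 1" | n where "j = Suc (Suc n)"
        by (metis One_nat_def not0_implies_Suc)
      then show "t j \<le> t 0 + t 1 + ennreal K * ennreal M"
      proof cases
        case (3 n)
        have "t j \<le> ennreal K * ennreal M"
          unfolding 3 by (rule order_trans[OF tSuc mult_left_mono[OF M]]) simp
        then show ?thesis by (simp add: add_increasing)
      qed (simp_all add: add_increasing add_increasing2)
    qed
    also have "\<dots> < \<infinity>"
      using tfin by (simp add: ennreal_mult_less_top)
    finally show ?thesis
      using True by (simp add: wav_norm_def t_def)
  next
    case False
    define s where "s = enn2real q"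
    have s: "1 \<le> s" using one_le_enn2real[OF q False] by (simp add: s_def)
    have "(\<Sum>j. epow (t j) s) = epow (t 0) s + (epow (t 1) s + (\<Sum>n. epow (t (Suc (Suc n))) s))"
      by (simp add: suminf_ennreal_Suc[of "\<lambda>j. epow (t j) s"] suminf_ennreal_Suc[of "\<lambda>n. epow (t (Suc n)) s"])
    also have "\<dots> \<le> epow (t 0) s + (epow (t 1) s + (\<Sum>n. epow (ennreal K) s * epow (a (Suc n)) s))"
      using s tSuc by (intro add_left_mono suminf_le) (auto simp: epow_mult[symmetric] intro!: epow_mono)
    also have "\<dots> < \<infinity>"
      using besov_weighted_omega_summable[OF b \<alpha> q False fin] tfin
      by (simp add: ennreal_mult_less_top epow_ennreal a_def s_def)
    finally show ?thesis
      using False by (simp add: wav_norm_def t_def s_def)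
  qed
qed

subsection \<open>Cell averages and convergence of the Haar series\<close>

text \<open>On \<open>{0..<1}\<close> this is the conditional expectation on the b-adic cells of
  level \<open>n\<close>. Selecting the cell through the floor makes it visibly Borel
  measurable.\<close>

definition cell_average :: "nat \<Rightarrow> (real \<Rightarrow> real) \<Rightarrow> nat \<Rightarrow> real \<Rightarrow> real" where
  "cell_average b f n x = real b ^ n * cell_integral b f n (nat \<lfloor>x * real b ^ n\<rfloor>)"

lemma cell_average_eq: "0 < b \<Longrightarrow> x \<in> cell b n m \<Longrightarrow> cell_average b f n x = real b ^ n * cell_integral b f n m"
  by (simp add: cell_average_def in_cell_iff_floor)

lemma obtain_cell:
  assumes "0 < b" "x \<in> {0..<1}"
  obtains m where "x \<in> cell b n m" "m < b ^ n"
proof -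
  have "0 \<le> x * real b ^ n"
    using assms by simp
  then have floor: "0 \<le> \<lfloor>x * real b ^ n\<rfloor>" by simp
  have "x * real b ^ n < 1 * real b ^ n"
    using assms by (intro mult_strict_right_mono) auto
  then have "\<lfloor>x * real b ^ n\<rfloor> < int (b ^ n)"
    by (simp add: floor_less_iff)
  with floor have "nat \<lfloor>x * real b ^ n\<rfloor> < b ^ n" by linarith
  moreover have "x \<in> cell b n (nat \<lfloor>x * real b ^ n\<rfloor>)"
    using assms(1) floor by (simp add: in_cell_iff_floor)
  ultimately show ?thesis using that by blast
qed

lemma haar_level_0:
  assumes "x \<in> {0..<1}"
  shows "(\<Sum>k\<in>Kset b 0. \<Sum>i\<in>Iset b 0. wcoef b f 0 i k * haar b 0 i k x) = cell_average b f 0 x"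
proof -
  have "wcoef b f 0 0 0 = cell_integral b f 0 0"
    unfolding wcoef_def cell_integral_def set_lebesgue_integral_def
    by (intro Bochner_Integration.integral_cong) (auto simp: haar_def cell_def split: split_indicator)
  moreover have "\<lfloor>x\<rfloor> = 0"
    using assms by (simp add: floor_eq_iff)
  ultimately show ?thesis
    using assms by (simp add: Kset_def Iset_def haar_def cell_average_def)
qed

text \<open>Only the block of the parent of \<open>x\<close> contributes. Its \<open>b\<close> Haar
  functions sum to zero and so are no basis, but the same cancellation among the coefficients leaves
  just the term of the child containing \<open>x\<close>.\<close>

lemma haar_level_Suc:
  assumes f: "integrable lebesgue f" and b: "0 < b" and x: "x \<in> {0..<1}"
  shows "(\<Sum>k\<in>Kset b (Suc n). \<Sum>i\<in>Iset b (Suc n). wcoef b f (Suc n) i k * haar b (Suc n) i k x)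
    = cell_average b f (Suc n) x - cell_average b f n x"
proof -
  obtain k0 where k0: "x \<in> cell b n k0" "k0 < b ^ n"
    using obtain_cell[OF b x] .
  obtain i0 where i0: "x \<in> cell b (Suc n) (b * k0 + i0)" "i0 < b"
    using k0(1) in_cell_Suc_iff[OF b] by blast
  define c where "c = real b powr (real (Suc n) / 2 - 1)"
  define a where "a i = cell_integral b f (Suc n) (b * k0 + i)" for i
  define A where "A = cell_integral b f n k0"
  have haar_eq: "haar b (Suc n) i k x = c * (real b * indicator (cell b (Suc n) (b * k + i)) x - indicator (cell b n k) x)" for i k
    unfolding haar_def cell_def c_def by (simp only: nat.simps(3) if_False diff_Suc_1)
  have coarse: "x \<in> cell b n k \<longleftrightarrow> k = k0" for k
    using k0(1) b by (auto simp: in_cell_iff_floor)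
  have fine: "x \<in> cell b (Suc n) m \<longleftrightarrow> m = b * k0 + i0" for m
    using i0(1) unfolding in_cell_iff_floor[OF b] by (metis of_nat_eq_iff)
  have off: "haar b (Suc n) i k x = 0" if "k \<noteq> k0" "i < b" for i k
  proof -
    have "b * k + i \<noteq> b * k0 + i0"
    proof
      assume "b * k + i = b * k0 + i0"
      then have "(b * k + i) div b = (b * k0 + i0) div b" by simp
      then show False using that i0(2) by simp
    qed
    then show ?thesis
      using that by (simp add: haar_eq coarse fine)
  qed
  have on: "haar b (Suc n) i k0 x = c * (real b * (if i = i0 then 1 else 0) - 1)" for i
    unfolding haar_eq by (simp add: coarse fine indicator_def)
  have sum_a: "(\<Sum>i<b. a i) = A"
    unfolding a_def A_def by (rule cell_integral_Suc[OF f b, symmetric])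
  \<comment> \<open>The squared normalisation turns integrals into averages: one factor
    \<open>b\<close> gives \<open>b ^ n\<close> for the parent, two give \<open>b ^ Suc n\<close>
    for the child.\<close>
  have cc: "c * c * (real b * real b) = real b ^ Suc n"
  proof -
    have "c * c = real b powr (real (Suc n) - 2)"
      unfolding c_def powr_add[symmetric] by simp
    moreover have "real b * real b = real b powr 2"
      using b by (simp add: powr_numeral power2_eq_square)
    ultimately have "c * c * (real b * real b) = real b powr real (Suc n)"
      by (simp only: powr_add[symmetric]) simp
    then show ?thesis
      using b by (simp only: powr_realpow of_nat_0_less_iff)
  qed
  then have cb: "c * c * real b = real b ^ n"
    using b by simp
  have KI: "Kset b (Suc n) = {..<b ^ n}" "Iset b (Suc n) = {..<b}"
    by (auto simp: Kset_def Iset_def)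
  have "(\<Sum>k<b ^ n. \<Sum>i<b. wcoef b f (Suc n) i k * haar b (Suc n) i k x)
      = (\<Sum>k\<in>{k0}. \<Sum>i<b. wcoef b f (Suc n) i k * haar b (Suc n) i k x)"
    using k0(2) off by (intro sum.mono_neutral_right) auto
  also have "\<dots> = (\<Sum>i<b. c * (real b * a i - A) * (c * (real b * (if i = i0 then 1 else 0) - 1)))"
    using wcoef_Suc[OF f b k0(2)] by (simp add: on c_def a_def A_def del: power_Suc of_nat_Suc)
  also have "\<dots> = (\<Sum>i<b. c * c * real b * (if i = i0 then real b * a i - A else 0)) - c * c * (\<Sum>i<b. real b * a i - A)"
    unfolding sum_distrib_left[of "c * c"] sum_subtractf[symmetric]
    by (intro sum.cong refl) (simp add: algebra_simps)
  \<comment> \<open>The children's integrals add up to \<open>A\<close>, so the part of the Haar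
    functions that does not depend on \<open>i\<close> drops out.\<close>
  also have "(\<Sum>i<b. real b * a i - A) = 0"
    using sum_a by (simp add: sum_subtractf sum_distrib_left[symmetric])
  also have "(\<Sum>i<b. c * c * real b * (if i = i0 then real b * a i - A else 0)) = c * c * real b * (real b * a i0 - A)"
    using i0(2) by (simp add: sum_distrib_left[symmetric])
  also have "\<dots> - c * c * 0 = c * c * (real b * real b) * a i0 - c * c * real b * A"
    by (simp add: algebra_simps)
  finally show ?thesis
    unfolding KI cc cb using cell_average_eq[OF b i0(1)] cell_average_eq[OF b k0(1)] by (simp add: a_def A_def)
qed

text \<open>The levels telescope. Levels 0 to \<open>J\<close> are \<open>Suc J\<close> levels,
  whence the offset.\<close>

lemma haar_partial_sum:
  assumes "integrable lebesgue f" "0 < b" "x \<in> {0..<1}"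
  shows "(\<Sum>j<Suc J. \<Sum>k\<in>Kset b j. \<Sum>i\<in>Iset b j. wcoef b f j i k * haar b j i k x) = cell_average b f J x"
proof (induction J)
  case 0
  then show ?case
    using haar_level_0[OF assms(3)] by simp
next
  case (Suc J)
  then show ?case
    using haar_level_Suc[OF assms] by (subst sum.lessThan_Suc) (simp only:)
qed

lemma borel_measurable_cell_average [measurable]: "cell_average b f n \<in> borel_measurable borel"
  unfolding cell_average_def by measurable

section \<open>Distance in L1 between a function and its cell averages\<close>

text \<open>The integrand is symmetric in the two points \<open>x\<close> and \<open>x + h\<close>,
  so a negative step becomes a positive one by translating \<open>x\<close> by \<open>- h\<close>.
  The two indicators keep both points in the unit interval.\<close>

lemma shift_integral_sym_le:
  fixes g :: "real \<Rightarrow> real"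
  assumes [measurable]: "g \<in> borel_measurable borel"
    and W: "\<And>h. 0 < h \<Longrightarrow> h \<le> \<delta> \<Longrightarrow> (\<integral>\<^sup>+x\<in>{0..1 - h}. ennreal \<bar>g (x + h) - g x\<bar> \<partial>lborel) \<le> W"
    and h: "\<bar>h\<bar> \<le> \<delta>"
  shows "(\<integral>\<^sup>+x. ennreal \<bar>g (x + h) - g x\<bar> * indicator {0..<1} x * indicator {0..<1} (x + h) \<partial>lborel) \<le> W"
proof -
  have pos: "(\<integral>\<^sup>+x. ennreal \<bar>g (x + h) - g x\<bar> * indicator {0..<1} x * indicator {0..<1} (x + h) \<partial>lborel) \<le> W"
    if "0 < h" "h \<le> \<delta>" for h
  proof -
    have "(\<integral>\<^sup>+x. ennreal \<bar>g (x + h) - g x\<bar> * indicator {0..<1} x * indicator {0..<1} (x + h) \<partial>lborel)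
        \<le> (\<integral>\<^sup>+x\<in>{0..1 - h}. ennreal \<bar>g (x + h) - g x\<bar> \<partial>lborel)"
      by (intro nn_integral_mono) (auto split: split_indicator)
    also have "\<dots> \<le> W" by (rule W[OF that])
    finally show ?thesis .
  qed
  consider "h = 0" | "0 < h" | "h < 0" by linarith
  then show ?thesis
  proof cases
    case 3
    have "(\<integral>\<^sup>+x. ennreal \<bar>g (x + h) - g x\<bar> * indicator {0..<1} x * indicator {0..<1} (x + h) \<partial>lborel)
       = (\<integral>\<^sup>+x. ennreal \<bar>g (- h + 1 * x + h) - g (- h + 1 * x)\<bar> * indicator {0..<1} (- h + 1 * x)
           * indicator {0..<1} (- h + 1 * x + h) \<partial>lborel)"
      by (subst nn_integral_real_affine[where c = 1 and t = "- h"]) auto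
    also have "\<dots> = (\<integral>\<^sup>+x. ennreal \<bar>g (x + - h) - g x\<bar> * indicator {0..<1} x * indicator {0..<1} (x + - h) \<partial>lborel)"
      by (intro nn_integral_cong) (simp add: abs_minus_commute mult.commute mult.left_commute)
    also have "\<dots> \<le> W"
      using 3 h by (intro pos) auto
    finally show ?thesis .
  qed (use pos h in auto)
qed

text \<open>Points of one cell are at most \<delta> = 1/b^n apart, so the error at \<open>x\<close>
  is at most b^n times the integral of |g(x + h) - g(x)| over |h| \<le> \<delta>. After Fubini each
  \<open>h\<close> contributes at most \<open>W\<close>, and b^n * 2\<delta> = 2.\<close>

lemma cell_average_L1_le_borel:
  fixes g :: "real \<Rightarrow> real"
  assumes g[measurable]: "g \<in> borel_measurable borel" and int: "integrable lebesgue g" and b: "0 < b"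
    and W: "\<And>h. 0 < h \<Longrightarrow> h \<le> 1 / real b ^ n \<Longrightarrow> (\<integral>\<^sup>+x\<in>{0..1 - h}. ennreal \<bar>g (x + h) - g x\<bar> \<partial>lborel) \<le> W"
  shows "(\<integral>\<^sup>+x\<in>{0..<1}. ennreal \<bar>cell_average b g n x - g x\<bar> \<partial>lborel) \<le> 2 * W"
proof -
  let ?\<delta> = "1 / real b ^ n"
  \<comment> \<open>The cell of \<open>x\<close> is replaced by the larger window of all admissible
    \<open>h\<close>, which no longer depends on \<open>x\<close> except through the unit interval;
    the order of integration can then be exchanged.\<close>
  define G where "G x h = ennreal \<bar>g (x + h) - g x\<bar> * indicator {0..<1} x * indicator {0..<1} (x + h) * indicator {-?\<delta>..?\<delta>} h" for x h
  have pw: "ennreal \<bar>cell_average b g n x - g x\<bar> * indicator {0..<1} x \<le> ennreal (real b ^ n) * (\<integral>\<^sup>+h. G x h \<partial>lborel)" for x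
  proof (cases "x \<in> {0..<1}")
    case True
    obtain m where m: "x \<in> cell b n m" "m < b ^ n"
      using obtain_cell[OF b True] .
    have cell_unit: "cell b n m \<subseteq> {0..<1}"
    proof -
      have "real (m + 1) \<le> real (b ^ n)"
        unfolding of_nat_le_iff using m(2) by simp
      then have "real (m + 1) / real b ^ n \<le> 1"
        using b by simp
      moreover have "0 \<le> real m / real b ^ n"
        by simp
      ultimately show ?thesis
        unfolding cell_def by (intro subsetI) (simp only: atLeastLessThan_iff; linarith)
    qed
    have near: "\<bar>y - x\<bar> \<le> ?\<delta>" if "y \<in> cell b n m" for y
      using that m(1) b unfolding cell_def by (auto simp: add_divide_distrib)
    have meas: "measure lebesgue (cell b n m) = ?\<delta>"
      using emeasure_cell[OF b, of n m] by (simp add: measure_def)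
    have int_cell: "integrable lebesgue (\<lambda>y. indicator (cell b n m) y *\<^sub>R (g y - g x))"
    proof -
      have "integrable lebesgue (\<lambda>y. indicator (cell b n m) y *\<^sub>R g x)"
        using emeasure_cell[OF b, of n m] by (intro integrable_scaleR_left) (auto simp: integrable_indicator_iff)
      then show ?thesis
        using integrable_mult_indicator[OF cell_sets_lebesgue int, of b n m]
        by (simp only: scaleR_diff_right Bochner_Integration.integrable_diff)
    qed
    have "(\<integral>y. indicator (cell b n m) y *\<^sub>R (g y - g x) \<partial>lebesgue)
        = (\<integral>y. indicator (cell b n m) y *\<^sub>R g y \<partial>lebesgue) - (\<integral>y. indicator (cell b n m) y *\<^sub>R g x \<partial>lebesgue)"
      unfolding scaleR_diff_right
      using integrable_mult_indicator[OF cell_sets_lebesgue int, of b n m] emeasure_cell[OF b, of n m]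
      by (intro Bochner_Integration.integral_diff integrable_scaleR_left) (auto simp: integrable_indicator_iff)
    also have "(\<integral>y. indicator (cell b n m) y *\<^sub>R g x \<partial>lebesgue) = ?\<delta> * g x"
      using meas by simp
    finally have "cell_average b g n x - g x = real b ^ n * (\<integral>y. indicator (cell b n m) y *\<^sub>R (g y - g x) \<partial>lebesgue)"
      using b by (simp add: cell_average_eq[OF b m(1)] cell_integral_def set_lebesgue_integral_def right_diff_distrib)
    then have "ennreal \<bar>cell_average b g n x - g x\<bar>
        = ennreal (real b ^ n) * ennreal (norm (\<integral>y. indicator (cell b n m) y *\<^sub>R (g y - g x) \<partial>lebesgue))"
      by (simp add: abs_mult ennreal_mult)
    also have "\<dots> \<le> ennreal (real b ^ n) * (\<integral>\<^sup>+y. ennreal (norm (indicator (cell b n m) y *\<^sub>R (g y - g x))) \<partial>lebesgue)"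
      by (intro mult_left_mono integral_norm_bound_ennreal int_cell) simp
    also have "(\<integral>\<^sup>+y. ennreal (norm (indicator (cell b n m) y *\<^sub>R (g y - g x))) \<partial>lebesgue)
        \<le> (\<integral>\<^sup>+y. G x (y - x) \<partial>lebesgue)"
    proof (rule nn_integral_mono)
      fix y
      show "ennreal (norm (indicator (cell b n m) y *\<^sub>R (g y - g x))) \<le> G x (y - x)"
        using near[of y] cell_unit True by (cases "y \<in> cell b n m") (auto simp: G_def abs_le_iff)
    qed
    also have "(\<integral>\<^sup>+y. G x (y - x) \<partial>lebesgue) = (\<integral>\<^sup>+y. G x (y - x) \<partial>lborel)"
      by (rule nn_integral_completion)
    also have "\<dots> = (\<integral>\<^sup>+h. G x (x + 1 * h - x) \<partial>lborel)"
      unfolding G_def by (subst nn_integral_real_affine[where c = 1 and t = x]) auto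
    finally show ?thesis
      using True by (simp add: mult_left_mono)
  qed simp
  have [measurable]: "(\<lambda>(x, h). G x h) \<in> borel_measurable (lborel \<Otimes>\<^sub>M lborel)"
    unfolding G_def by measurable
  have "(\<integral>\<^sup>+x\<in>{0..<1}. ennreal \<bar>cell_average b g n x - g x\<bar> \<partial>lborel)
      \<le> (\<integral>\<^sup>+x. ennreal (real b ^ n) * (\<integral>\<^sup>+h. G x h \<partial>lborel) \<partial>lborel)"
    by (intro nn_integral_mono pw)
  also have "\<dots> = ennreal (real b ^ n) * (\<integral>\<^sup>+x. \<integral>\<^sup>+h. G x h \<partial>lborel \<partial>lborel)"
    by (rule nn_integral_cmult) measurable
  also have "(\<integral>\<^sup>+x. \<integral>\<^sup>+h. G x h \<partial>lborel \<partial>lborel) = (\<integral>\<^sup>+h. \<integral>\<^sup>+x. G x h \<partial>lborel \<partial>lborel)"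
    by (rule lborel_pair.Fubini'[symmetric]) measurable
  also have "\<dots> \<le> (\<integral>\<^sup>+h. W * indicator {-?\<delta>..?\<delta>} h \<partial>lborel)"
  proof (rule nn_integral_mono)
    fix h
    show "(\<integral>\<^sup>+x. G x h \<partial>lborel) \<le> W * indicator {-?\<delta>..?\<delta>} h"
      using shift_integral_sym_le[where g = g and \<delta> = ?\<delta> and W = W and h = h, OF g W]
      by (cases "h \<in> {-?\<delta>..?\<delta>}") (auto simp: G_def abs_le_iff)
  qed
  also have "\<dots> = W * ennreal (2 * ?\<delta>)"
    using b by (simp add: nn_integral_cmult_indicator)
  also have "ennreal (real b ^ n) * (W * ennreal (2 * ?\<delta>)) = 2 * W"
  proof -
    have "ennreal (real b ^ n) * ennreal (2 * ?\<delta>) = 2"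
      using b by (simp add: ennreal_mult[symmetric])
    then show ?thesis
      by (simp add: mult.commute mult.left_commute)
  qed
  finally show ?thesis
    by (simp add: mult_left_mono)
qed

text \<open>Translates of null sets are null. Thus a function altered on a null set may be altered
  at \<open>x\<close> and at \<open>x + h\<close> at once.\<close>

lemma AE_lebesgue_shift:
  fixes h :: real
  assumes "AE x in lebesgue. P x"
  shows "AE x in lebesgue. P (x + h)"
proof -
  have "AE x in lborel. P x"
    using assms by (simp add: AE_completion_iff)
  then obtain N where N: "N \<in> null_sets lborel" "{x. \<not> P x} \<subseteq> N"
    by (auto simp: eventually_ae_filter)
  have "{x. x - (- h) \<in> N} \<in> null_sets lborel"
    by (rule null_sets_translation[OF N(1)])
  then have "AE x in lborel. P (x + h)"
    using N(2) by (auto simp: eventually_ae_filter intro!: bexI[of _ "{x. x - (- h) \<in> N}"])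
  then show ?thesis
    by (rule AE_completion)
qed

text \<open>The Fubini argument runs over \<open>lborel\<close> with Borel functions, so
  \<open>f\<close> is replaced by a Borel representative. Cell averages and all integrals involved
  stay the same.\<close>

lemma cell_average_L1_le:
  assumes int: "integrable lebesgue f" and b: "0 < b"
    and W: "\<And>h. 0 < h \<Longrightarrow> h \<le> 1 / real b ^ n \<Longrightarrow> (\<integral>\<^sup>+x\<in>{0..1 - h}. ennreal \<bar>f (x + h) - f x\<bar> \<partial>lebesgue) \<le> W"
  shows "(\<integral>\<^sup>+x\<in>{0..<1}. ennreal \<bar>cell_average b f n x - f x\<bar> \<partial>lebesgue) \<le> 2 * W"
proof -
  have f[measurable]: "f \<in> borel_measurable lebesgue"
    using int by auto
  obtain g where g: "g \<in> borel_measurable lborel" and fg: "AE x in lborel. f x = g x"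
    using completion_ex_borel_measurable_real[OF f] by auto
  have gb[measurable]: "g \<in> borel_measurable borel"
    using g by simp
  have gl[measurable]: "g \<in> borel_measurable lebesgue"
    using measurable_completion[OF g] by simp
  have fgl: "AE x in lebesgue. f x = g x"
    by (rule AE_completion[OF fg])
  have gint: "integrable lebesgue g"
    by (rule integrable_cong_AE_imp[OF int gl]) (use fgl in \<open>auto elim: eventually_mono\<close>)
  have "cell_integral b f n m = cell_integral b g n m" for m
    unfolding cell_integral_def set_lebesgue_integral_def
    using fgl by (intro integral_cong_AE) (auto elim!: eventually_mono)
  then have avg: "cell_average b f n = cell_average b g n"
    by (simp add: cell_average_def fun_eq_iff)
  have Wg: "(\<integral>\<^sup>+x\<in>{0..1 - h}. ennreal \<bar>g (x + h) - g x\<bar> \<partial>lborel) \<le> W" if "0 < h" "h \<le> 1 / real b ^ n" for h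
  proof -
    have "(\<integral>\<^sup>+x\<in>{0..1 - h}. ennreal \<bar>g (x + h) - g x\<bar> \<partial>lborel) = (\<integral>\<^sup>+x\<in>{0..1 - h}. ennreal \<bar>g (x + h) - g x\<bar> \<partial>lebesgue)"
      by (rule nn_integral_completion[symmetric])
    also have "\<dots> = (\<integral>\<^sup>+x\<in>{0..1 - h}. ennreal \<bar>f (x + h) - f x\<bar> \<partial>lebesgue)"
      using fgl AE_lebesgue_shift[OF fgl, of h] by (intro nn_integral_cong_AE) auto
    also have "\<dots> \<le> W" by (rule W[OF that])
    finally show ?thesis .
  qed
  have "(\<integral>\<^sup>+x\<in>{0..<1}. ennreal \<bar>cell_average b f n x - f x\<bar> \<partial>lebesgue)
      = (\<integral>\<^sup>+x\<in>{0..<1}. ennreal \<bar>cell_average b g n x - g x\<bar> \<partial>lebesgue)"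
    unfolding avg using fgl by (intro nn_integral_cong_AE) auto
  also have "\<dots> = (\<integral>\<^sup>+x\<in>{0..<1}. ennreal \<bar>cell_average b g n x - g x\<bar> \<partial>lborel)"
    by (rule nn_integral_completion)
  also have "\<dots> \<le> 2 * W"
    by (rule cell_average_L1_le_borel[OF gb gint b Wg])
  finally show ?thesis .
qed

text \<open>The moduli decay geometrically, hence so do the L1 errors of the averages. The sum of
  the errors is then integrable and finite almost everywhere, which forces the errors to tend to
  0.\<close>

lemma haar_series_AE_converges:
  assumes int: "integrable lebesgue f" and b: "2 \<le> b" and \<alpha>: "0 < \<alpha>" and p: "1 \<le> p"
    and fin: "besov_norm \<alpha> p \<infinity> f < \<infinity>"
  shows "AE x in lebesgue_on {0..1}.
    (\<lambda>J. \<Sum>j<J. \<Sum>k \<in> Kset b j. \<Sum>i \<in> Iset b j. wcoef b f j i k * haar b j i k x) \<longlonglongrightarrow> f x"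
proof -
  have b0: "0 < b" using b by simp
  have f_meas[measurable]: "f \<in> borel_measurable lebesgue"
    using int by auto
  have avg[measurable]: "cell_average b f n \<in> borel_measurable lebesgue" for n
    using measurable_completion[of "cell_average b f n" lborel borel] by simp
  obtain M where M: "0 \<le> M"
    "\<And>n. ennreal (real b powr (real (Suc n) * \<alpha>)) * omega p f (real b powr - real (Suc n)) \<le> ennreal M"
    using besov_weighted_omega_bounded[OF b \<alpha> fin] by blast
  define \<rho> where "\<rho> = real b powr - \<alpha>"
  have \<rho>: "0 < \<rho>" "\<rho> < 1"
    using b \<alpha> by (auto simp: \<rho>_def powr_less_one)
  have omega_le: "omega p f (real b powr - real (Suc n)) \<le> ennreal (\<rho> ^ Suc n * M)" (is "?\<omega> \<le> _") for n
  proof -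
    have \<rho>_pow: "\<rho> ^ Suc n = real b powr - (real (Suc n) * \<alpha>)"
      using b by (simp add: \<rho>_def powr_realpow[symmetric] powr_powr mult.commute del: power_Suc of_nat_Suc)
    have "ennreal (\<rho> ^ Suc n) * (ennreal (real b powr (real (Suc n) * \<alpha>)) * ?\<omega>) \<le> ennreal (\<rho> ^ Suc n) * ennreal M"
      by (intro mult_left_mono M) simp
    moreover have "ennreal (\<rho> ^ Suc n) * ennreal (real b powr (real (Suc n) * \<alpha>)) = 1"
      unfolding \<rho>_pow using b by (simp add: ennreal_mult[symmetric] powr_add[symmetric])
    ultimately show ?thesis
      using \<rho> M(1) by (simp add: mult.assoc[symmetric] ennreal_mult del: power_Suc)
  qed
  have L1: "(\<integral>\<^sup>+x\<in>{0..<1}. ennreal \<bar>cell_average b f (Suc n) x - f x\<bar> \<partial>lebesgue) \<le> 2 * ennreal (\<rho> ^ Suc n * M)" for n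
  proof (rule cell_average_L1_le[OF int b0])
    fix h :: real assume h: "0 < h" "h \<le> 1 / real b ^ Suc n"
    have pow: "1 / real b ^ Suc n = real b powr - real (Suc n)"
      using b by (simp add: powr_minus powr_realpow field_simps del: power_Suc of_nat_Suc)
    \<comment> \<open>Starting at exponent \<open>Suc n\<close> keeps \<open>h\<close> below 1, so
      \<open>{0..1 - h}\<close> has positive measure for Hoelder's inequality.\<close>
    have "1 / real b ^ Suc n < 1"
      using b one_less_power[of "real b" "Suc n"] by (simp del: power_Suc)
    then have h1: "0 < 1 - h" using h by linarith
    have [measurable]: "(\<lambda>x. f (x + h) - f x) \<in> borel_measurable lebesgue"
      by (intro borel_measurable_diff borel_measurable_shift) auto
    have "(\<integral>\<^sup>+x\<in>{0..1 - h}. ennreal \<bar>f (x + h) - f x\<bar> \<partial>lebesgue)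
        \<le> ennreal ((1 - h) powr (1 - inv_exp p)) * Lp_norm_on p {0..1 - h} (\<lambda>x. f (x + h) - f x)"
      using h1 by (intro nn_integral_le_Lp_norm_on p) auto
    also have "\<dots> \<le> 1 * omega p f (real b powr - real (Suc n))"
    proof (rule mult_mono)
      have "inv_exp p \<le> 1"
        using one_le_enn2real[OF p] by (auto simp: inv_exp_def)
      then have "(1 - h) powr (1 - inv_exp p) \<le> 1"
        using h h1 by (intro powr_le1) auto
      then show "ennreal ((1 - h) powr (1 - inv_exp p)) \<le> 1"
        by (metis ennreal_1 ennreal_leI)
      show "Lp_norm_on p {0..1 - h} (\<lambda>x. f (x + h) - f x) \<le> omega p f (real b powr - real (Suc n))"
        using h pow by (intro Lp_norm_on_shift_le_omega) auto
    qed auto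
    finally show "(\<integral>\<^sup>+x\<in>{0..1 - h}. ennreal \<bar>f (x + h) - f x\<bar> \<partial>lebesgue) \<le> ennreal (\<rho> ^ Suc n * M)"
      using omega_le[of n] by (simp only: mult_1)
  qed
  let ?e = "\<lambda>n x. ennreal \<bar>cell_average b f (Suc n) x - f x\<bar> * indicator {0..<1} x"
  have e_meas: "?e n \<in> borel_measurable lebesgue" for n
    by (intro borel_measurable_times_ennreal borel_measurable_indicator
      measurable_compose[OF _ measurable_ennreal] borel_measurable_abs borel_measurable_diff avg f_meas) simp
  have "(\<integral>\<^sup>+x. (\<Sum>n. ?e n x) \<partial>lebesgue) = (\<Sum>n. \<integral>\<^sup>+x. ?e n x \<partial>lebesgue)"
    by (rule nn_integral_suminf) (rule e_meas)
  also have "\<dots> \<le> (\<Sum>n. 2 * ennreal (\<rho> ^ Suc n * M))"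
    by (intro suminf_le L1) auto
  also have "\<dots> = 2 * (\<Sum>n. ennreal (\<rho> ^ Suc n * M))"
    by simp
  also have "(\<Sum>n. ennreal (\<rho> ^ Suc n * M)) = ennreal (\<Sum>n. \<rho> ^ Suc n * M)"
    using \<rho> M(1) by (intro suminf_ennreal2 summable_mult2 summable_mult) (auto intro: summable_mult summable_geometric)
  finally have "(\<integral>\<^sup>+x. (\<Sum>n. ?e n x) \<partial>lebesgue) < \<infinity>"
    by (rule le_less_trans) (simp add: ennreal_mult_less_top)
  then have "AE x in lebesgue. (\<Sum>n. ?e n x) \<noteq> \<infinity>"
    by (intro nn_integral_PInf_AE borel_measurable_suminf_order e_meas) (auto simp: less_top)
  \<comment> \<open>The cells are half-open and leave out the right endpoint of the unit interval,
    which is a null set.\<close>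
  moreover have "AE x in lebesgue. x \<noteq> (1::real)"
    using AE_completion[OF AE_lborel_singleton[of "1::real"]] .
  ultimately have "AE x in lebesgue. x \<in> {0..1} \<longrightarrow>
    (\<lambda>J. \<Sum>j<J. \<Sum>k \<in> Kset b j. \<Sum>i \<in> Iset b j. wcoef b f j i k * haar b j i k x) \<longlonglongrightarrow> f x"
  proof eventually_elim
    case (elim x)
    show ?case
    proof
      assume "x \<in> {0..1}"
      then have x: "x \<in> {0..<1}" using elim by auto
      then have "(\<Sum>n. ennreal \<bar>cell_average b f (Suc n) x - f x\<bar>) \<noteq> top"
        using elim(1) by simp
      then have "summable (\<lambda>n. \<bar>cell_average b f (Suc n) x - f x\<bar>)"
        by (intro summable_suminf_not_top) auto
      then have "(\<lambda>n. \<bar>cell_average b f (Suc n) x - f x\<bar>) \<longlonglongrightarrow> 0"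
        by (rule summable_LIMSEQ_zero)
      then have "(\<lambda>n. cell_average b f (Suc n) x) \<longlonglongrightarrow> f x"
        by (simp add: tendsto_rabs_zero_iff LIM_zero_iff)
      \<comment> \<open>One \<open>Suc\<close> comes from the averages having been estimated from
        level 1 on, the other from the number of levels in a partial sum. Neither affects the
        limit.\<close>
      then have "(\<lambda>n. \<Sum>j<Suc (Suc n). \<Sum>k \<in> Kset b j. \<Sum>i \<in> Iset b j. wcoef b f j i k * haar b j i k x) \<longlonglongrightarrow> f x"
        by (simp only: haar_partial_sum[OF int b0 x])
      then show "(\<lambda>J. \<Sum>j<J. \<Sum>k \<in> Kset b j. \<Sum>i \<in> Iset b j. wcoef b f j i k * haar b j i k x) \<longlonglongrightarrow> f x"
        by (simp only: filterlim_sequentially_Suc[of "\<lambda>J. \<Sum>j<J. \<Sum>k \<in> Kset b j. \<Sum>i \<in> Iset b j. wcoef b f j i k * haar b j i k x"]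
          filterlim_sequentially_Suc[of "\<lambda>J. \<Sum>j<Suc J. \<Sum>k \<in> Kset b j. \<Sum>i \<in> Iset b j. wcoef b f j i k * haar b j i k x"])
    qed
  qed
  then show ?thesis
    by (simp add: AE_restrict_space_iff)
qed

section \<open>Dependence on the values in the unit interval only, and the embedding\<close>

lemma Lp_norm_on_cong:
  assumes eq: "\<And>x. x \<in> S \<Longrightarrow> f x = g x" and S: "S \<in> sets lebesgue"
  shows "Lp_norm_on p S f = Lp_norm_on p S g"
proof -
  let ?M = "lebesgue_on S"
  \<comment> \<open>The essential supremum of a non-measurable function is \<open>top\<close>, so
    measurability is carried from \<open>v\<close> to \<open>u\<close> before the values are
    compared.\<close>
  have le: "esssup ?M (\<lambda>x. ennreal \<bar>u x\<bar>) \<le> esssup ?M (\<lambda>x. ennreal \<bar>v x\<bar>)"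
    if uv: "\<And>x. x \<in> S \<Longrightarrow> u x = v x" for u v :: "real \<Rightarrow> real"
  proof (cases "(\<lambda>x. ennreal \<bar>v x\<bar>) \<in> borel_measurable ?M")
    case True
    then have "(\<lambda>x. ennreal \<bar>u x\<bar>) \<in> borel_measurable ?M"
      by (subst measurable_cong[where g = "\<lambda>x. ennreal \<bar>v x\<bar>"]) (auto simp: uv)
    then show ?thesis
      using uv by (intro esssup_AE_mono) auto
  qed (simp add: esssup_non_measurable)
  have "esssup ?M (\<lambda>x. ennreal \<bar>f x\<bar>) = esssup ?M (\<lambda>x. ennreal \<bar>g x\<bar>)"
    using le[of f g] le[of g f] eq by (simp add: antisym)
  moreover have "(\<integral>\<^sup>+x\<in>S. epow (ennreal \<bar>f x\<bar>) r \<partial>lebesgue) = (\<integral>\<^sup>+x\<in>S. epow (ennreal \<bar>g x\<bar>) r \<partial>lebesgue)" for r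
    using eq by (intro nn_integral_cong) (auto split: split_indicator)
  ultimately show ?thesis
    by (simp add: Lp_norm_on_def)
qed

text \<open>For \<open>x\<close> in \<open>{0..1 - h}\<close> with h > 0 both \<open>x\<close> and
  \<open>x + h\<close> lie in the unit interval; for h > 1 the domain is empty.\<close>

lemma omega_cong:
  assumes "\<And>x. x \<in> {0..1} \<Longrightarrow> f x = g x"
  shows "omega p f \<delta> = omega p g \<delta>"
  unfolding omega_def using assms by (intro SUP_cong refl Lp_norm_on_cong) auto

lemma wcoef_cong:
  assumes "\<And>x. x \<in> {0..1} \<Longrightarrow> f x = g x"
  shows "wcoef b f j i k = wcoef b g j i k"
  unfolding wcoef_def using assms by (intro set_lebesgue_integral_cong) auto

theorem theorem8:
  fixes b :: nat and \<alpha> :: real and p q :: ennreal and f :: "real \<Rightarrow> real"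
  assumes "b \<ge> 2" and "0 < \<alpha>" and "\<alpha> < 1"
    and "1 \<le> p" and "1 \<le> q"
    and "f \<in> besov_space \<alpha> p q"
  shows "wav_norm b \<alpha> p q f
           \<le> ennreal (max 1 (2 powr (inv_exp p) * (1 - 1 / real b) * real b powr \<alpha>)) * besov_norm_b b \<alpha> p q f
         \<and> f \<in> wav_space b \<alpha> p q"
proof -
  have meas: "f \<in> borel_measurable (lebesgue_on {0..1})" and fin: "besov_norm \<alpha> p q f < \<infinity>"
    using assms(6) by (auto simp: besov_space_def)
  \<comment> \<open>The values of \<open>f\<close> outside the unit interval are arbitrary. The
    extension by zero is measurable on the whole line, and the norms and coefficients do not see the
    change.\<close>
  define g where "g x = indicator {0..1} x *\<^sub>R f x" for x
  have eq: "f x = g x" if "x \<in> {0..1}" for x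
    using that by (simp add: g_def)
  have [measurable]: "g \<in> borel_measurable lebesgue"
    using meas unfolding g_def by (subst (asm) borel_measurable_restrict_space_iff) auto
  have omega_eq: "omega p f = omega p g"
    using eq by (intro ext omega_cong) auto
  have Lp_eq: "Lp_norm_on p {0..1} f = Lp_norm_on p {0..1} g"
    using eq by (intro Lp_norm_on_cong) auto
  have wcoef_eq: "wcoef b f = wcoef b g"
    using eq by (intro ext wcoef_cong) auto
  have wav_eq: "wav_norm b \<alpha> p q f = wav_norm b \<alpha> p q g"
    unfolding wav_norm_def level_norm_def wcoef_eq ..
  have fin_g: "besov_norm \<alpha> p q g < \<infinity>"
    using fin unfolding besov_norm_def omega_eq Lp_eq .
  \<comment> \<open>Hoelder's inequality on the unit interval bounds the L1 norm by the p-norm, a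
    summand of the finite Besov norm.\<close>
  have int: "integrable lebesgue g"
  proof (rule integrableI_bounded)
    have "(\<integral>\<^sup>+x. ennreal (norm (g x)) \<partial>lebesgue) = (\<integral>\<^sup>+x\<in>{0..1}. ennreal \<bar>g x\<bar> \<partial>lebesgue)"
      by (intro nn_integral_cong) (auto simp: g_def split: split_indicator)
    also have "\<dots> \<le> ennreal (1 powr (1 - inv_exp p)) * Lp_norm_on p {0..1} g"
      by (intro nn_integral_le_Lp_norm_on assms) auto
    also have "\<dots> < \<infinity>"
      using fin_g by (auto simp: besov_norm_def)
    finally show "(\<integral>\<^sup>+x. ennreal (norm (g x)) \<partial>lebesgue) < \<infinity>" .
  qed simp
  have "integrable (lebesgue_on {0..1}) f"
    using int unfolding g_def by (subst integrable_restrict_space) auto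
  moreover have "wav_norm b \<alpha> p q f < \<infinity>"
    unfolding wav_eq by (rule wav_norm_less_top[OF int assms(1,2,4,5) fin_g])
  moreover have "AE x in lebesgue_on {0..1}.
      (\<lambda>J. \<Sum>j<J. \<Sum>k \<in> Kset b j. \<Sum>i \<in> Iset b j. wcoef b f j i k * haar b j i k x) \<longlonglongrightarrow> f x" if "q = \<infinity>"
    using haar_series_AE_converges[OF int assms(1,2,4)] fin_g that
    unfolding wcoef_eq by (auto simp: AE_restrict_space_iff eq elim!: eventually_mono)
  ultimately have "f \<in> wav_space b \<alpha> p q"
    by (simp add: wav_space_def)
  moreover have "wav_norm b \<alpha> p q f
      \<le> ennreal (max 1 (2 powr (inv_exp p) * (1 - 1 / real b) * real b powr \<alpha>)) * besov_norm_b b \<alpha> p q f"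
    using wav_norm_le_besov_norm_b[OF int assms(1,4,5), of \<alpha>]
    unfolding wav_eq besov_norm_b_def omega_eq Lp_eq .
  ultimately show ?thesis
    by blast
qed

end
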